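(* Let $d \geq 2$ be an integer and let $p$ be an odd prime with $p\equiv \pm1 \pmod d$. Then \[ {}_{3}G\left( \tfrac{1}{2}, \tfrac{1}{d} , 1-\tfrac{1}{d} \right)_p \equiv {}_{3}F_2\left[ \begin{array}{ccc} \frac{1}{2}, & \frac{1}{d}, & 1-\frac{1}{d}\\ & 1, &1 \end{array} \Big| \; 1 \right]_{p-1} \pmod {p^2}. \]
   Context: $\Gamma_p$ is Morita's $p$-adic gamma function. For real $x$, $\lfloor x\rfloor$ is the floor and $\langle x\rangle:=x-\lfloor x\rfloor$. For an odd prime $p$, $n\in\mathbb{Z}^+$ and $\frac{m_i}{d_i}\in\mathbb{Q}\cap\mathbb{Z}_p$ with $0<\frac{m_i}{d_i}<1$, define ${}_{n+1}G\left(\tfrac{m_1}{d_1},\dots,\tfrac{m_{n+1}}{d_{n+1}}\right)_p:=\frac{-1}{p-1}\sum_{j=0}^{p-2}\left((-1)^j\Gamma_p(\tfrac{j}{p-1})\right)^{n+1}\prod_{i=1}^{n+1}\frac{\Gamma_p(\langle \frac{m_i}{d_i}-\frac{j}{p-1}\rangle)}{\Gamma_p(\frac{m_i}{d_i})}(-p)^{-\lfloor \frac{m_i}{d_i}-\frac{j}{p-1}\rfloor}$. Rising factorial: $(a)_0:=1$, $(a)_k:=a(a+1)\cdots(a+k-1)$. Truncated hypergeometric series: ${}_rF_s\left[\begin{array}{ccc}a_1,&\dots,&a_r\\ &b_1,\dots,&b_s\end{array}\Big|\,z\right]_m:=\sum_{k=0}^{m}\frac{(a_1)_k\cdots(a_r)_k}{(b_1)_k\cdots(b_s)_k}\frac{z^k}{k!}$.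 Congruences are in $\mathbb{Z}_p$. *)

theory Defs
  imports
    Complex_Main
    "HOL-Computational_Algebra.Polynomial_Factorial"
    "HOL-Number_Theory.Cong"
    "Berlekamp_Zassenhaus.Finite_Field"
begin

text \<open>
  The prime \<open>p\<close> is the cardinality of the type parameter. A \<open>p\<close>-adic integer is an element of the
  inverse limit of the rings \<open>\<int>/p\<^sup>n\<int>\<close>, given by its coherent sequence of least nonnegative residues.
\<close>

typedef (overloaded) ('p :: prime_card) padic_int =
    "{x :: nat \<Rightarrow> int. \<forall>n. x (Suc n) mod int CARD('p) ^ n = x n}"
  morphisms padic_residue Abs_padic_int
  by (rule exI[of _ "\<lambda>_. 0"]) simp

setup_lifting type_definition_padic_int

lemma coherent_mod:
  fixes x :: "nat \<Rightarrow> int" and q :: int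
  assumes "\<And>n. x (Suc n) mod q ^ n = x n" and "n \<le> m"
  shows "x m mod q ^ n = x n"
  using \<open>n \<le> m\<close>
proof (induction m rule: dec_induct)
  case base
  show ?case using assms(1)[of n] by (metis mod_mod_trivial)
next
  case (step m)
  have "x (Suc m) mod q ^ n = x (Suc m) mod q ^ m mod q ^ n"
    using step.hyps by (simp add: mod_mod_cancel le_imp_power_dvd)
  then show ?case using step.IH assms(1)[of m] by simp
qed

lemma padic_residue_mod:
  fixes x :: "'p :: prime_card padic_int"
  assumes "n \<le> m"
  shows "padic_residue x m mod int CARD('p) ^ n = padic_residue x n"
  using coherent_mod[OF _ assms, of "padic_residue x" "int CARD('p)"] padic_residue[of x] by simp

lemma padic_int_eqI: "(\<And>n. padic_residue x n = padic_residue y n) \<Longrightarrow> x = y"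
  by (simp add: padic_residue_inject[symmetric] ext)

lemma mod_Suc_power_mod: "(a :: int) mod q ^ Suc n mod q ^ n = a mod q ^ n"
  by (rule mod_mod_cancel) simp

instantiation padic_int :: (prime_card) comm_ring_1
begin

lift_definition zero_padic_int :: "'a padic_int" is "\<lambda>_. 0" by simp

lift_definition one_padic_int :: "'a padic_int" is "\<lambda>n. 1 mod int CARD('a) ^ n"
  by (simp only: mod_Suc_power_mod simp_thms)

lift_definition plus_padic_int :: "'a padic_int \<Rightarrow> 'a padic_int \<Rightarrow> 'a padic_int"
  is "\<lambda>x y n. (x n + y n) mod int CARD('a) ^ n"
  by (metis mod_Suc_power_mod mod_add_eq)

lift_definition times_padic_int :: "'a padic_int \<Rightarrow> 'a padic_int \<Rightarrow> 'a padic_int"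
  is "\<lambda>x y n. (x n * y n) mod int CARD('a) ^ n"
  by (metis mod_Suc_power_mod mod_mult_eq)

lift_definition uminus_padic_int :: "'a padic_int \<Rightarrow> 'a padic_int"
  is "\<lambda>x n. (- x n) mod int CARD('a) ^ n"
  by (metis mod_Suc_power_mod mod_minus_eq)

definition minus_padic_int :: "'a padic_int \<Rightarrow> 'a padic_int \<Rightarrow> 'a padic_int"
  where "minus_padic_int x y = x + (- y)"

instance
proof
  fix x y z :: "'a padic_int"
  have m: "padic_residue x n mod int CARD('a) ^ n = padic_residue x n" for x :: "'a padic_int" and n
    by (simp add: padic_residue_mod)
  note [simp] = zero_padic_int.rep_eq one_padic_int.rep_eq plus_padic_int.rep_eq
    times_padic_int.rep_eq uminus_padic_int.rep_eq m
  show "x * y * z = x * (y * z)" by (rule padic_int_eqI) (simp add: mod_simps ac_simps)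
  show "x * y = y * x" by (rule padic_int_eqI) (simp add: ac_simps)
  show "1 * x = x" by (rule padic_int_eqI) (simp add: mod_simps)
  show "x + y + z = x + (y + z)" by (rule padic_int_eqI) (simp add: mod_simps ac_simps)
  show "x + y = y + x" by (rule padic_int_eqI) (simp add: ac_simps)
  show "0 + x = x" by (rule padic_int_eqI) simp
  show "- x + x = 0" by (rule padic_int_eqI) (simp add: mod_simps)
  show "x - y = x + - y" by (simp add: minus_padic_int_def)
  show "(x + y) * z = x * z + y * z"
    by (rule padic_int_eqI) (simp add: mod_simps algebra_simps)
  show "(0 :: 'a padic_int) \<noteq> 1"
  proof
    assume "(0 :: 'a padic_int) = 1"
    then have "padic_residue (0 :: 'a padic_int) 1 = padic_residue (1 :: 'a padic_int) 1" by simp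
    then show False using prime_gt_1_int[OF prime_card_int[where 'a = 'a]] by simp
  qed
qed

end

lemma padic_residue_of_nat:
  "padic_residue (of_nat k :: 'p :: prime_card padic_int) n = int k mod int CARD('p) ^ n"
  by (induction k)
    (simp_all add: zero_padic_int.rep_eq one_padic_int.rep_eq plus_padic_int.rep_eq mod_simps)

instance padic_int :: (prime_card) idom
proof
  fix x y :: "'a padic_int"
  assume "x \<noteq> 0" "y \<noteq> 0"
  let ?q = "int CARD('a)"
  obtain n where n: "padic_residue x n \<noteq> 0"
    using \<open>x \<noteq> 0\<close> padic_int_eqI[of x 0] by (auto simp: zero_padic_int.rep_eq)
  obtain m where m: "padic_residue y m \<noteq> 0"
    using \<open>y \<noteq> 0\<close> padic_int_eqI[of y 0] by (auto simp: zero_padic_int.rep_eq)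
  let ?a = "padic_residue x (n + m)" and ?b = "padic_residue y (n + m)"
  have a: "\<not> ?q ^ n dvd ?a" using n padic_residue_mod[of n "n + m" x] by (simp add: dvd_eq_mod_eq_0)
  have b: "\<not> ?q ^ m dvd ?b" using m padic_residue_mod[of m "n + m" y] by (simp add: dvd_eq_mod_eq_0)
  have p: "prime_elem ?q" using prime_card_int[where 'a = 'a] by simp
  have u: "\<not> is_unit ?q" using p prime_elem_not_unit by blast
  have ab: "?a \<noteq> 0" "?b \<noteq> 0" using a b by auto
  have "multiplicity ?q ?a < n" using a ab u by (meson power_dvd_iff_le_multiplicity not_le)
  moreover have "multiplicity ?q ?b < m" using b ab u by (meson power_dvd_iff_le_multiplicity not_le)
  ultimately have "multiplicity ?q (?a * ?b) < n + m"
    using ab p by (simp add: prime_elem_multiplicity_mult_distrib)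
  then have "\<not> ?q ^ (n + m) dvd ?a * ?b"
    using ab u by (meson mult_eq_0_iff power_dvd_iff_le_multiplicity not_le)
  then have "padic_residue (x * y) (n + m) \<noteq> padic_residue 0 (n + m)"
    by (simp add: times_padic_int.rep_eq zero_padic_int.rep_eq dvd_eq_mod_eq_0)
  then show "x * y \<noteq> 0" by metis
qed

instance padic_int :: (prime_card) ring_char_0
proof
  show "inj (of_nat :: nat \<Rightarrow> 'a padic_int)"
  proof (rule injI)
    fix k l :: nat
    assume eq: "(of_nat k :: 'a padic_int) = of_nat l"
    let ?q = "int CARD('a)"
    have "1 < CARD('a)" using prime_gt_1_nat[OF prime_card] .
    then have "k + l < CARD('a) ^ (k + l)" by (simp add: less_exp power_gt_expt)
    then have "int (k + l) < ?q ^ (k + l)" by (metis of_nat_less_iff of_nat_power)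
    then have "int k < ?q ^ (k + l)" "int l < ?q ^ (k + l)" by linarith+
    moreover have "int k mod ?q ^ (k + l) = int l mod ?q ^ (k + l)"
      using eq by (metis padic_residue_of_nat)
    ultimately show "k = l" by simp
  qed
qed

text \<open>
  The \<open>p\<close>-adic metric: the distance of \<open>x \<noteq> y\<close> is \<open>p\<close> to the power \<open>-n\<close>, where \<open>n\<close> is the largest
  number with \<open>x \<equiv> y\<close> modulo \<open>p\<^sup>n\<close>.
\<close>

instantiation padic_int :: (prime_card) metric_space
begin

definition dist_padic_int :: "'a padic_int \<Rightarrow> 'a padic_int \<Rightarrow> real" where
  "dist x y = (if x = y then 0
     else 1 / real CARD('a) ^ (GREATEST n. padic_residue x n = padic_residue y n))"

definition uniformity_padic_int :: "('a padic_int \<times> 'a padic_int) filter" where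
  "uniformity_padic_int = (INF e\<in>{0<..}. principal {(x, y). dist x y < e})"

definition open_padic_int :: "'a padic_int set \<Rightarrow> bool" where
  "open_padic_int U \<longleftrightarrow> (\<forall>x\<in>U. eventually (\<lambda>(x', y). x' = x \<longrightarrow> y \<in> U) uniformity)"

instance
proof
  show "uniformity = (INF e\<in>{0<..}. principal {(x :: 'a padic_int, y). dist x y < e})"
    by (rule uniformity_padic_int_def)
  show "open U \<longleftrightarrow> (\<forall>x\<in>U. eventually (\<lambda>(x', y). x' = x \<longrightarrow> y \<in> U) uniformity)"
    for U :: "'a padic_int set"
    by (rule open_padic_int_def)
next
  fix x y z :: "'a padic_int"
  show "dist x y = 0 \<longleftrightarrow> x = y" by (simp add: dist_padic_int_def)
  define v where "v x y = (GREATEST n. padic_residue x n = padic_residue y n)"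
    for x y :: "'a padic_int"
  have down: "padic_residue x n = padic_residue y n"
    if "padic_residue x m = padic_residue y m" "n \<le> m" for x y :: "'a padic_int" and n m
    using that by (metis padic_residue_mod)
  have bnd: "\<exists>b. \<forall>n. padic_residue x n = padic_residue y n \<longrightarrow> n \<le> b"
    if "x \<noteq> y" for x y :: "'a padic_int"
    using that padic_int_eqI[of x y] down[of x _ y] by (meson linear)
  have v: "padic_residue x n = padic_residue y n \<longleftrightarrow> n \<le> v x y"
    if ne: "x \<noteq> y" for x y :: "'a padic_int" and n
  proof -
    obtain b where b: "\<And>n. padic_residue x n = padic_residue y n \<Longrightarrow> n \<le> b"
      using bnd[OF ne] by blast
    have z: "padic_residue x 0 = padic_residue y 0"
      using padic_residue_mod[of 0 0 x] padic_residue_mod[of 0 0 y] by simp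
    have "padic_residue x (v x y) = padic_residue y (v x y)"
      unfolding v_def by (rule GreatestI_nat[of _ 0 b]) (use z b in auto)
    moreover have "n \<le> v x y" if "padic_residue x n = padic_residue y n"
      unfolding v_def by (rule Greatest_le_nat[of _ n b]) (use that b in auto)
    ultimately show ?thesis using down by blast
  qed
  have d: "dist x y = (if x = y then 0 else 1 / real CARD('a) ^ v x y)" for x y :: "'a padic_int"
    by (simp add: dist_padic_int_def v_def)
  have p: "1 < real CARD('a)" using prime_gt_1_nat[OF prime_card[where 'a = 'a]] by simp
  show "dist x y \<le> dist x z + dist y z"
  proof (cases "x = y \<or> x = z \<or> y = z")
    case True
    have "v y z = v z y" unfolding v_def by (simp add: eq_commute)
    then show ?thesis using True p by (auto simp: d)
  next
    case False
    have "min (v x z) (v y z) \<le> v x y"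
      using v[of x z] v[of y z] v[of x y] False
      by (metis min.cobounded1 min.cobounded2)
    then have "1 / real CARD('a) ^ v x y \<le> 1 / real CARD('a) ^ min (v x z) (v y z)"
      using p by (intro divide_left_mono power_increasing) auto
    also have "\<dots> \<le> 1 / real CARD('a) ^ v x z + 1 / real CARD('a) ^ v y z"
      by (auto simp: min_def)
    finally show ?thesis using False by (simp add: d)
  qed
qed

end

instance fract :: ("{idom, ring_char_0}") field_char_0
proof
  show "inj (of_nat :: nat \<Rightarrow> 'a fract)"
    by (rule injI) (simp add: of_nat_fract eq_fract)
qed

text \<open>The field \<open>\<rat>\<^sub>p\<close>, as the field of fractions of \<open>\<int>\<^sub>p\<close>.\<close>

type_synonym 'p padic = "'p padic_int fract"

text \<open>Only meaningful for rational numbers whose denominator is prime to \<open>p\<close>.\<close>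

definition padic_int_of_rat :: "rat \<Rightarrow> 'p :: prime_card padic_int" where
  "padic_int_of_rat r = (THE x. to_fract x = of_rat r)"

text \<open>Congruence in \<open>\<int>\<^sub>p\<close>: that both sides lie in \<open>\<int>\<^sub>p\<close> is part of the assertion.\<close>

definition padic_cong :: "'p :: prime_card padic \<Rightarrow> 'p padic \<Rightarrow> nat \<Rightarrow> bool" where
  "padic_cong x y m \<longleftrightarrow>
     (\<exists>a b. x = to_fract a \<and> y = to_fract b \<and> of_nat m dvd a - b)"

definition padic_Gamma_nat :: "nat \<Rightarrow> 'p :: prime_card padic_int" where
  "padic_Gamma_nat n = (-1) ^ n * (\<Prod>j | 0 < j \<and> j < n \<and> \<not> CARD('p) dvd j. of_nat j)"

text \<open>The limit is taken over positive integers \<open>n\<close> approaching \<open>x\<close> in the \<open>p\<close>-adic metric.\<close>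

definition padic_Gamma :: "'p :: prime_card padic_int \<Rightarrow> 'p padic_int" where
  "padic_Gamma x = (if x = 0 then 1
     else Lim (inf (filtercomap of_nat (nhds x)) (principal {0<..})) padic_Gamma_nat)"

abbreviation padic_Gamma_rat :: "rat \<Rightarrow> 'p :: prime_card padic" where
  "padic_Gamma_rat r \<equiv> to_fract (padic_Gamma (padic_int_of_rat r))"

text \<open>
  The list of parameters has length \<open>n + 1\<close>; its entries are rational numbers strictly between
  0 and 1 whose denominators are prime to \<open>p\<close>.
\<close>

definition padic_G :: "rat list \<Rightarrow> 'p :: prime_card padic" where
  "padic_G ms =
     (- 1 / (of_nat CARD('p) - 1)) *
     (\<Sum>j = 0..CARD('p) - 2.
        let t = of_nat j / (of_nat CARD('p) - 1)
        in ((-1) ^ j * padic_Gamma_rat t) ^ length ms *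
           (\<Prod>m\<leftarrow>ms. padic_Gamma_rat (frac (m - t)) / padic_Gamma_rat m *
              (- of_nat CARD('p)) powi (- \<lfloor>m - t\<rfloor>)))"

definition truncated_hypergeometric :: "'a list \<Rightarrow> 'a list \<Rightarrow> 'a \<Rightarrow> nat \<Rightarrow> 'a :: field_char_0" where
  "truncated_hypergeometric as bs z m =
     (\<Sum>k = 0..m. (\<Prod>a\<leftarrow>as. pochhammer a k) / (\<Prod>b\<leftarrow>bs. pochhammer b k) * (z ^ k / fact k))"

end

theory Submission
  imports Defs "HOL-Number_Theory.Residue_Primitive_Roots"
begin

text \<open>
  Put \<open>h = (p - 1) / 2\<close> and \<open>r = \<lfloor>(p - 1) / d\<rfloor>\<close>. Modulo \<open>p\<close> the parameters are \<open>h + 1\<close>, \<open>r + 1\<close> and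
  \<open>p - r\<close>, so the \<open>j\<close>-th term \<open>F\<^sub>j\<close> of the hypergeometric sum is \<open>R(j) / R(0)\<close> modulo \<open>p\<close> with
  \<open>R(x) = (x+1)\<cdots>(x+h) \<cdot> (x+1)\<cdots>(x+r) \<cdot> (x+1)\<cdots>(x+p-1-r)\<close>. In the \<open>j\<close>-th term \<open>G\<^sub>j\<close> of the
  \<open>G\<close>-function the argument \<open>j/(p-1)\<close> is \<open>-(j + pj)\<close> modulo \<open>p\<^sup>2\<close>; since
  \<open>\<Gamma>\<^sub>p(x + pk)/\<Gamma>\<^sub>p(x)\<close> is multiplicative in \<open>k\<close> modulo \<open>p\<^sup>2\<close>, the functional equation and the
  reflection formula show that \<open>G\<^sub>j\<close> is \<open>F\<^sub>j\<close> with \<open>R(j)\<close> replaced by \<open>R(j + pj)\<close>. Together with the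
  factor \<open>-1/(p-1) \<equiv> 1 + p\<close> this gives \<open>(1 + p) G\<^sub>j \<equiv> F\<^sub>j + p f'(j)/R(0)\<close> modulo \<open>p\<^sup>2\<close> for
  \<open>f = x R\<close>, and the same congruence holds for \<open>j > r\<close>, where powers of \<open>p\<close> appear on both sides.
  Finally \<open>f'(0) + \<cdots> + f'(p-1) \<equiv> 0\<close> modulo \<open>p\<close>: the power sums of exponent \<open>k < 2p - 2\<close> vanish
  unless \<open>k = p - 1\<close>, and \<open>f'\<close>, whose degree is \<open>p + h - 1\<close>, has a coefficient divisible by \<open>p\<close> there.
\<close>

subsection \<open>Wilson's theorem modulo prime powers and integer values of Morita's gamma function\<close>

text \<open>With \<open>g\<close> a primitive root, the product is \<open>g\<close> to the power
  \<open>T * (T - 1) / 2\<close>, that is \<open>s ^ (T - 1)\<close> for a square root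
  \<open>s\<close> of 1 other than 1. Since \<open>T\<close> is even, the exponent is odd, and
  oddness of \<open>p\<close> forces \<open>s\<close> to be -1.\<close>

lemma prod_totatives_odd_prime_power:
  assumes "prime p" "odd p" "k > 0"
  shows "[(\<Prod>i\<in>totatives (p ^ k). int i) = -1] (mod int (p ^ k))"
proof -
  define m where "m = p ^ k"
  define T where "T = totient m"
  obtain g where g: "residue_primroot m g"
    using residue_primroot_odd_prime_power_exists[OF assms(1,2)] assms(3) unfolding m_def by metis
  have p2: "p > 2"
    using assms(1,2) prime_ge_2_nat[of p] by (cases "p = 2") auto
  have "p ^ 1 \<le> m"
    unfolding m_def using assms(3) p2 by (intro power_increasing) auto
  then have m2: "m > 2" using p2 by simp
  have evT: "even T" unfolding T_def using totient_even m2 by simp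
  have T0: "T > 0" unfolding T_def using m2 by simp
  have cop: "coprime m g" and ordg: "ord m g = T"
    using g by (auto simp: residue_primroot_def T_def)
  define s where "s = int g ^ (T div 2)"
  have "[(\<Prod>i\<in>totatives m. int i) = (\<Prod>i<T. int (g ^ i mod m))] (mod int m)"
    using prod.reindex_bij_betw[OF residue_primroot_is_generator[of m g], of int] m2 g
    by (simp add: T_def)
  also have "[(\<Prod>i<T. int (g ^ i mod m)) = (\<Prod>i<T. int g ^ i)] (mod int m)"
    by (intro cong_prod) (simp add: cong_def of_nat_mod)
  also have "(\<Prod>i<T. int g ^ i) = int g ^ (\<Sum>i<T. i)"
    by (simp add: power_sum)
  also have "(\<Sum>i<T. i) = T div 2 * (T - 1)"
    using evT by (simp add: Sum_Ico_nat lessThan_atLeast0) (metis dvd_div_mult)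
  also have "int g ^ (T div 2 * (T - 1)) = s ^ (T - 1)"
    by (simp add: s_def power_mult)
  also have "[s ^ (T - 1) = (-1) ^ (T - 1)] (mod int m)"
  proof (rule cong_pow)
    have "[g ^ T = 1] (mod m)" using ordg ord_divides[of g T m] by simp
    then have "[int g ^ T = 1] (mod int m)" by (metis cong_int_iff of_nat_1 of_nat_power)
    moreover have "s * s = int g ^ T" using evT by (simp add: s_def flip: power_add mult_2)
    ultimately have "int m dvd s * s - 1" by (simp add: cong_iff_dvd_diff)
    then have dv: "int p ^ k dvd (s - 1) * (s + 1)"
      by (simp add: m_def algebra_simps)
    have ns: "\<not> int p ^ k dvd s - 1"
    proof
      assume "int p ^ k dvd s - 1"
      then have "[int g ^ (T div 2) = 1] (mod int m)" by (simp add: s_def m_def cong_iff_dvd_diff)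
      then have "[g ^ (T div 2) = 1] (mod m)" by (metis cong_int_iff of_nat_1 of_nat_power)
      then have "T dvd T div 2" using ordg ord_divides[of g "T div 2" m] by simp
      then show False using T0 evT by (auto dest!: dvd_imp_le)
    qed
    have pp: "prime (int p)" using assms(1) by simp
    \<comment> \<open>As \<open>p > 2\<close>, one of the two factors is coprime to
      \<open>p\<close>, so the whole power of \<open>p\<close> divides the other. The order of
      \<open>g\<close> excludes \<open>s - 1\<close> by \<open>ns\<close>.\<close>
    have "\<not> (int p dvd s - 1 \<and> int p dvd s + 1)"
    proof
      assume "int p dvd s - 1 \<and> int p dvd s + 1"
      then have "int p dvd (s + 1) - (s - 1)" using dvd_diff by blast
      then have "int p dvd 2" by simp
      then show False using p2 zdvd_imp_le by fastforce
    qed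
    then have "coprime (int p ^ k) (s - 1) \<or> coprime (int p ^ k) (s + 1)"
      using prime_imp_coprime[OF pp] by auto
    then have "int p ^ k dvd s + 1"
      using dv ns by (metis coprime_dvd_mult_right_iff coprime_dvd_mult_left_iff)
    then show "[s = -1] (mod int m)" by (simp add: cong_iff_dvd_diff m_def)
  qed
  also have "(-1 :: int) ^ (T - 1) = -1" using evT T0 by simp
  finally show ?thesis unfolding m_def .
qed

text \<open>The integer that represents \<open>padic_Gamma_nat n\<close>, with \<open>p\<close> as
  an ordinary number, so that the arithmetic of the gamma function can be done with integer
  congruences.\<close>

definition morita :: "nat \<Rightarrow> nat \<Rightarrow> int" where
  "morita p n = (-1) ^ n * (\<Prod>j | 0 < j \<and> j < n \<and> \<not> p dvd j. int j)"

lemma morita_0 [simp]: "morita p 0 = 1"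
  by (simp add: morita_def)

text \<open>The functional equation of Morita's function. It covers \<open>n = 0\<close> as well,
  because \<open>p dvd 0\<close>.\<close>

lemma morita_Suc: "morita p (Suc n) = - (if p dvd n then 1 else int n) * morita p n"
proof -
  have "{j. 0 < j \<and> j < Suc n \<and> \<not> p dvd j} =
      (if p dvd n then {j. 0 < j \<and> j < n \<and> \<not> p dvd j} else insert n {j. 0 < j \<and> j < n \<and> \<not> p dvd j})"
    by (cases "n = 0") (auto simp: less_Suc_eq)
  then show ?thesis by (simp add: morita_def)
qed

lemma morita_add:
  "morita p (n + k) = (-1) ^ k * (\<Prod>i<k. if p dvd n + i then 1 else int (n + i)) * morita p n"
  by (induction k) (simp_all add: morita_Suc)

lemma coprime_morita:
  assumes "prime p"
  shows "coprime (morita p n) (int p)"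
proof (induction n)
  case (Suc n)
  have "\<not> p dvd n \<Longrightarrow> coprime n p"
    using prime_imp_coprime[OF assms, of n] by (simp add: coprime_commute)
  then show ?case using Suc.IH by (auto simp: morita_Suc)
qed simp

lemma morita_prime_power:
  assumes "prime p" "odd p" "k > 0"
  shows "[morita p (p ^ k) = 1] (mod int p ^ k)"
proof -
  have "{j. 0 < j \<and> j < p ^ k \<and> \<not> p dvd j} = totatives (p ^ k)"
    using assms prime_imp_coprime[of p] coprime_power_right_iff[of _ p k] prime_gt_1_nat[of p]
    by (auto simp: totatives_def coprime_commute coprime_absorb_right order.order_iff_strict)
  then have "morita p (p ^ k) = - (\<Prod>i\<in>totatives (p ^ k). int i)"
    using assms(2) by (simp add: morita_def)
  then show ?thesis
    using prod_totatives_odd_prime_power[OF assms] cong_minus_minus_iff by fastforce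
qed

text \<open>The functional equation carries the case \<open>n = 0\<close>, which is Wilson's
  theorem, upwards: the new factors on both sides are congruent, and they are skipped
  simultaneously.\<close>

lemma morita_add_prime_power:
  assumes "prime p" "odd p" "k > 0"
  shows "[morita p (n + p ^ k) = morita p n] (mod int p ^ k)"
proof (induction n)
  case 0
  show ?case using morita_prime_power[OF assms] by simp
next
  case (Suc n)
  have "p dvd p ^ k" using assms(3) by simp
  then have "p dvd n + p ^ k \<longleftrightarrow> p dvd n" using dvd_add_left_iff by blast
  then show ?case
    using cong_mult[OF _ Suc.IH, of "- int (n + p ^ k)" "- int n"] cong_minus_minus_iff[of _ _ "int p ^ k"] Suc.IH
    by (auto simp: morita_Suc cong_iff_dvd_diff algebra_simps)
qed

text \<open>Iterates the period \<open>p ^ k\<close>. This uniform continuity in the p-adic metric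
  is what makes the limit defining the gamma function exist.\<close>

lemma morita_cong:
  assumes "prime p" "odd p" "k > 0" "[n = n'] (mod p ^ k)"
  shows "[morita p n = morita p n'] (mod int p ^ k)"
proof -
  have *: "[morita p (n + i * p ^ k) = morita p n] (mod int p ^ k)" for n i
  proof (induction i)
    case (Suc i)
    then show ?case
      using morita_add_prime_power[OF assms(1-3), of "n + i * p ^ k"] by (auto simp: ac_simps cong_def)
  qed simp
  from assms(4) have "n mod p ^ k = n' mod p ^ k" by (simp add: cong_def)
  then show ?thesis
    using *[of "n mod p ^ k" "n div p ^ k"] *[of "n' mod p ^ k" "n' div p ^ k"]
    unfolding mod_div_mult_eq cong_def by simp
qed

text \<open>Reflection formula, with \<open>p ^ 2 - x\<close> standing for \<open>-x\<close>. The
  exponent counts the integers from 1 to \<open>x\<close> prime to \<open>p\<close>: passing such an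
  integer brings in two factors that are opposite modulo \<open>p ^ 2\<close>, hence one sign
  change.\<close>

lemma morita_reflection:
  assumes "prime p" "odd p" "x < p ^ 2"
  shows "[morita p (p ^ 2 - x) * morita p (Suc x) = - ((-1) ^ (x - x div p))] (mod int p ^ 2)"
  using assms(3)
proof (induction x)
  case 0
  show ?case
    using morita_prime_power[OF assms(1,2), of 2]
    by (simp add: morita_Suc) (metis cong_minus_minus_iff)
next
  case (Suc x)
  define u where "u = morita p (p ^ 2 - Suc x)"
  define v where "v = morita p (Suc x)"
  have eq: "p ^ 2 - x = Suc (p ^ 2 - Suc x)" using Suc.prems by simp
  have dv: "p dvd p ^ 2 - Suc x \<longleftrightarrow> p dvd Suc x"
    using Suc.prems by (metis dvd_diff_nat dvd_diffD1 dvd_power less_or_eq_imp_le zero_less_numeral)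
  have IH: "[morita p (p ^ 2 - x) * v = - ((-1) ^ (x - x div p))] (mod int p ^ 2)"
    using Suc by (simp add: v_def)
  show ?case
  proof (cases "p dvd Suc x")
    case True
    then have "Suc x - Suc x div p = x - x div p"
      using div_Suc[of x p] by (simp add: mod_Suc dvd_eq_mod_eq_0 split: if_splits)
    then show ?thesis using IH dv True unfolding eq by (simp add: morita_Suc u_def v_def)
  next
    case False
    have "x div p \<le> x" by simp
    then have e: "Suc x - Suc x div p = Suc (x - x div p)"
      using False div_Suc[of x p] by (simp add: dvd_eq_mod_eq_0 Suc_diff_le)
    have 1: "morita p (p ^ 2 - x) = - (int p ^ 2 - int (Suc x)) * u"
      using False dv Suc.prems unfolding eq by (simp add: morita_Suc u_def of_nat_diff)
    have 2: "morita p (Suc (Suc x)) = - int (Suc x) * v"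
      using False by (simp add: morita_Suc v_def)
    have "[u * morita p (Suc (Suc x)) = - (morita p (p ^ 2 - x) * v)] (mod int p ^ 2)"
      unfolding 1 2 by (simp add: cong_iff_dvd_diff algebra_simps)
    also have "[- (morita p (p ^ 2 - x) * v) = - (- ((-1) ^ (x - x div p)))] (mod int p ^ 2)"
      using IH cong_minus_minus_iff by blast
    finally show ?thesis using e by (simp add: u_def)
  qed
qed

lemma morita_mult_cancel:
  assumes "prime p" "[morita p n * a = morita p n * b] (mod int p ^ k)"
  shows "[a = b] (mod int p ^ k)"
  using assms cong_mult_lcancel[of "morita p n" "int p ^ k" a b] coprime_morita[OF assms(1), of n]
  by simp

text \<open>The congruence passes from \<open>y\<close> to \<open>y + 1\<close> because
  \<open>y * (y + 2 * p)\<close> and \<open>(y + p) ^ 2\<close> differ by \<open>p ^ 2\<close>. One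
  starting value suffices; at \<open>p ^ 2 - p\<close> the reflection formula and Wilson's theorem
  give 1 on both sides.\<close>

lemma morita_second_difference:
  assumes "prime p" "odd p"
  shows "[morita p (y + 2 * p) * morita p y = morita p (y + p) ^ 2] (mod int p ^ 2)"
proof -
  let ?M = "\<lambda>y. [morita p (y + 2 * p) * morita p y = morita p (y + p) ^ 2] (mod int p ^ 2)"
  have p1: "p > 1" using assms(1) prime_gt_1_nat by blast
  then have pp: "p < p ^ 2" by (simp add: power2_eq_square)
  have start: "?M (p ^ 2 - p)"
  proof -
    have "[morita p (p ^ 2 - p) * morita p (Suc p) = - ((-1) ^ (p - p div p))] (mod int p ^ 2)"
      using morita_reflection[OF assms, of p] pp by simp
    then have "[- (morita p (p ^ 2 - p) * morita p p) = - 1] (mod int p ^ 2)"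
      using p1 assms(2) by (simp add: morita_Suc)
    then have a: "[morita p (p ^ 2 - p) * morita p p = 1] (mod int p ^ 2)"
      using cong_minus_minus_iff by blast
    have b: "[morita p (p + p ^ 2) = morita p p] (mod int p ^ 2)"
      using morita_add_prime_power[OF assms, of 2 p] by simp
    have c: "[morita p (p ^ 2) ^ 2 = 1] (mod int p ^ 2)"
      using cong_pow[OF morita_prime_power[OF assms, of 2], of 2] by simp
    have "[morita p (p + p ^ 2) * morita p (p ^ 2 - p) = morita p p * morita p (p ^ 2 - p)] (mod int p ^ 2)"
      using b by (rule cong_scalar_right)
    also have "[morita p p * morita p (p ^ 2 - p) = morita p (p ^ 2) ^ 2] (mod int p ^ 2)"
      using a c by (simp add: mult.commute cong_def)
    moreover have "p ^ 2 - p + 2 * p = p + p ^ 2" "p ^ 2 - p + p = p ^ 2" using pp by simp_all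
    ultimately show ?thesis by (simp add: cong_def)
  qed
  have step: "?M (Suc y)" if "?M y" for y
  proof (cases "p dvd y")
    case True
    then show ?thesis using that by (simp add: morita_Suc)
  next
    case False
    then have nd: "\<not> p dvd y + 2 * p" "\<not> p dvd y + p"
      by (simp_all add: dvd_add_left_iff)
    have "[int (y + 2 * p) * int y = int (y + p) ^ 2] (mod int p ^ 2)"
      by (simp add: cong_iff_dvd_diff algebra_simps power2_eq_square)
    from cong_mult[OF this that] show ?thesis
      using False nd by (simp add: morita_Suc power2_eq_square algebra_simps)
  qed
  \<comment> \<open>The induction only moves upwards from \<open>p ^ 2 - p\<close>. Taking
    \<open>y + p\<close> steps leads to \<open>y + p ^ 2\<close>, and the period
    \<open>p ^ 2\<close> brings the claim back to \<open>y\<close>.\<close>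
  have "?M (p ^ 2 - p + i)" for i
    by (induction i) (use start step in auto)
  then have "?M (p ^ 2 - p + (y + p))" .
  then have M: "?M (y + p ^ 2)" using pp by (simp add: ac_simps)
  have e: "[morita p (z + p ^ 2) = morita p z] (mod int p ^ 2)" for z
    using morita_add_prime_power[OF assms, of 2 z] by simp
  have "[morita p (y + 2 * p) * morita p y = morita p (y + p ^ 2 + 2 * p) * morita p (y + p ^ 2)] (mod int p ^ 2)"
    using cong_mult[OF e[of "y + 2 * p"] e[of y]] by (simp add: ac_simps cong_sym_eq)
  also note M
  also have "[morita p (y + p ^ 2 + p) ^ 2 = morita p (y + p) ^ 2] (mod int p ^ 2)"
    using cong_pow[OF e[of "y + p"], of 2] by (simp add: ac_simps)
  finally show ?thesis .
qed

text \<open>By the second-difference congruence the values at \<open>y + p * k\<close> form a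
  geometric progression in \<open>k\<close> modulo \<open>p ^ 2\<close>. The case
  \<open>b = 1\<close> comes first, by induction on \<open>k\<close>; then follows induction on
  \<open>b\<close>. The cancelled Morita values are prime to \<open>p\<close>.\<close>

lemma morita_shift_ratio:
  assumes "prime p" "odd p"
  shows "[morita p (y + p * k + p * b) * morita p y = morita p (y + p * k) * morita p (y + p * b)] (mod int p ^ 2)"
proof -
  have one: "[morita p (y + p * k + p) * morita p y = morita p (y + p * k) * morita p (y + p)] (mod int p ^ 2)" for y k
  proof (induction k)
    case (Suc k)
    define z where "z = y + p * k"
    have "[morita p z * (morita p (z + 2 * p) * morita p y) = morita p (z + p) ^ 2 * morita p y] (mod int p ^ 2)"
      using cong_scalar_right[OF morita_second_difference[OF assms, of z], of "morita p y"]
      by (simp add: ac_simps)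
    also have "morita p (z + p) ^ 2 * morita p y = morita p (z + p) * (morita p (z + p) * morita p y)"
      by (simp add: power2_eq_square)
    also have "[\<dots> = morita p (z + p) * (morita p z * morita p (y + p))] (mod int p ^ 2)"
      using Suc.IH by (intro cong_scalar_left) (simp add: z_def)
    finally have "[morita p z * (morita p (z + 2 * p) * morita p y) = morita p z * (morita p (z + p) * morita p (y + p))] (mod int p ^ 2)"
      by (simp add: ac_simps)
    from morita_mult_cancel[OF assms(1) this] show ?case
      by (simp add: z_def mult_2 mult_2_right algebra_simps)
  qed (simp add: mult.commute)
  show ?thesis
  proof (induction b)
    case (Suc b)
    define z where "z = y + p * b"
    have "[morita p z * (morita p (z + p * k + p) * morita p y) = morita p (z + p * k) * morita p (z + p) * morita p y] (mod int p ^ 2)"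
      using cong_scalar_right[OF one[of z k], of "morita p y"] by (simp add: ac_simps)
    also have "morita p (z + p * k) * morita p (z + p) * morita p y = morita p (z + p) * (morita p (y + p * k + p * b) * morita p y)"
      by (simp add: z_def ac_simps)
    also have "[\<dots> = morita p (z + p) * (morita p (y + p * k) * morita p z)] (mod int p ^ 2)"
      using Suc.IH by (intro cong_scalar_left) (simp add: z_def)
    finally have "[morita p z * (morita p (z + p * k + p) * morita p y) = morita p z * (morita p (y + p * k) * morita p (z + p))] (mod int p ^ 2)"
      by (simp add: ac_simps)
    from morita_mult_cancel[OF assms(1) this] show ?case by (simp add: z_def algebra_simps)
  qed simp
qed

subsection \<open>Sums of derivatives of polynomials over residues\<close>

text \<open>Telescoping \<open>(j + 1) ^ (k + 1) - j ^ (k + 1)\<close> expresses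
  \<open>k + 1\<close> times the power sum by \<open>p ^ (k + 1)\<close> and lower power sums;
  \<open>k + 1 < p\<close> allows division modulo \<open>p\<close>.\<close>

lemma prime_dvd_sum_powers:
  fixes p :: nat
  assumes "prime p" "k < p - 1"
  shows "int p dvd (\<Sum>j<p. int j ^ k)"
  using assms(2)
proof (induction k rule: less_induct)
  case (less k)
  define S where "S i = (\<Sum>j<p. int j ^ i)" for i
  have "int p ^ Suc k = (\<Sum>j<p. int (Suc j) ^ Suc k - int j ^ Suc k)"
    by (subst sum_lessThan_telescope) simp
  also have "\<dots> = (\<Sum>j<p. \<Sum>i\<le>k. of_nat (Suc k choose i) * int j ^ i)"
  proof (rule sum.cong[OF refl])
    fix j
    have "int (Suc j) ^ Suc k = (int j + 1) ^ Suc k" by (simp add: ac_simps)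
    also have "\<dots> = (\<Sum>i\<le>Suc k. of_nat (Suc k choose i) * int j ^ i)"
      by (subst binomial_ring) simp
    finally show "int (Suc j) ^ Suc k - int j ^ Suc k = (\<Sum>i\<le>k. of_nat (Suc k choose i) * int j ^ i)"
      by simp
  qed
  also have "\<dots> = (\<Sum>i\<le>k. of_nat (Suc k choose i) * S i)"
    by (subst sum.swap) (simp add: S_def sum_distrib_left)
  also have "\<dots> = (\<Sum>i<k. of_nat (Suc k choose i) * S i) + int (Suc k) * S k"
    by (simp add: lessThan_Suc_atMost[symmetric])
  finally have "int (Suc k) * S k = int p ^ Suc k - (\<Sum>i<k. of_nat (Suc k choose i) * S i)"
    by simp
  moreover have "int p dvd (\<Sum>i<k. of_nat (Suc k choose i) * S i)"
    using less by (intro dvd_sum dvd_mult) (auto simp: S_def)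
  ultimately have "int p dvd int (Suc k) * S k" by simp
  moreover have "\<not> int p dvd int (Suc k)"
    using less.prems by (auto dest!: zdvd_imp_le)
  ultimately have "int p dvd S k"
    using assms(1) prime_dvd_mult_iff[of "int p"] by (metis prime_nat_int_transfer)
  then show ?case by (simp add: S_def)
qed

text \<open>Exponents below \<open>p - 1\<close> have vanishing power sums, the coefficient at
  \<open>p - 1\<close> acquires a factor \<open>p\<close> from differentiation, and exponents from
  \<open>p\<close> to \<open>2 * p - 3\<close> are lowered by \<open>p - 1\<close> with Fermat's
  theorem into the first range.\<close>

lemma prime_dvd_sum_pderiv:
  fixes q :: "int poly" and p :: nat
  assumes "prime p" "degree q \<le> 2 * p - 2"
  shows "int p dvd (\<Sum>j<p. poly (pderiv q) (int j))"
proof -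
  have p2: "p \<ge> 2" using assms(1) prime_ge_2_nat by blast
  have "(\<Sum>j<p. poly (pderiv q) (int j)) =
      (\<Sum>i\<le>degree (pderiv q). coeff (pderiv q) i * (\<Sum>j<p. int j ^ i))"
    unfolding poly_altdef by (subst sum.swap) (simp add: sum_distrib_left)
  moreover have "int p dvd coeff (pderiv q) i * (\<Sum>j<p. int j ^ i)" if "i \<le> degree (pderiv q)" for i
  proof -
    have i: "i \<le> 2 * p - 3" using that assms(2) by (simp add: degree_pderiv)
    consider "i < p - 1" | "i = p - 1" | "i \<ge> p" using p2 by linarith
    then show ?thesis
    proof cases
      case 1
      then show ?thesis using prime_dvd_sum_powers[OF assms(1)] by simp
    next
      case 2
      then show ?thesis using p2 by (simp add: coeff_pderiv)
    next
      case 3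
      define k where "k = i - (p - 1)"
      have k: "i = (p - 1) + k" "0 < k" "k < p - 1" using 3 i p2 by (auto simp: k_def)
      have "[(\<Sum>j<p. int j ^ i) = (\<Sum>j<p. int j ^ k)] (mod int p)"
      proof (rule cong_sum)
        fix j assume "j \<in> {..<p}"
        show "[int j ^ i = int j ^ k] (mod int p)"
        proof (cases "j = 0")
          case True
          \<comment> \<open>Both exponents are positive here, so the summand at 0, to which Fermat's
            theorem does not apply, is 0 on both sides.\<close>
          then show ?thesis using k p2 by (simp add: power_0_left)
        next
          case False
          then have "\<not> p dvd j" using \<open>j \<in> {..<p}\<close> by (auto dest: dvd_imp_le)
          then have "[j ^ (p - 1) = 1] (mod p)" using fermat_theorem[OF assms(1)] by blast
          then have "[int j ^ (p - 1) = 1] (mod int p)" by (metis cong_int_iff of_nat_1 of_nat_power)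
          from cong_scalar_right[OF this, of "int j ^ k"] show ?thesis
            unfolding k(1) power_add by simp
        qed
      qed
      then have "int p dvd (\<Sum>j<p. int j ^ i)"
        using prime_dvd_sum_powers[OF assms(1) k(3)] cong_dvd_iff by blast
      then show ?thesis by simp
    qed
  qed
  ultimately show ?thesis by (auto intro!: dvd_sum)
qed

text \<open>First-order Taylor expansion, proved along Horner's scheme.\<close>

lemma poly_add_cong_pderiv:
  fixes q :: "int poly"
  shows "[poly q (x + h) = poly q x + h * poly (pderiv q) x] (mod h ^ 2)"
proof (induction q)
  case (pCons a q)
  then obtain k where k: "poly q (x + h) - (poly q x + h * poly (pderiv q) x) = h ^ 2 * k"
    by (auto simp: cong_iff_dvd_diff)
  have "poly (pCons a q) (x + h) - (poly (pCons a q) x + h * poly (pderiv (pCons a q)) x) =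
      (x + h) * (poly q (x + h) - (poly q x + h * poly (pderiv q) x)) + h ^ 2 * poly (pderiv q) x"
    by (simp add: pderiv_pCons algebra_simps power2_eq_square)
  also have "\<dots> = h ^ 2 * ((x + h) * k + poly (pderiv q) x)"
    unfolding k by (simp add: algebra_simps)
  finally show ?case by (simp add: cong_iff_dvd_diff)
qed simp

section \<open>Rising factorials as polynomials, so that they can be differentiated\<close>

definition rising_poly :: "nat \<Rightarrow> int poly" where
  "rising_poly s = (\<Prod>i<s. [:int (Suc i), 1:])"

lemma poly_rising_poly: "poly (rising_poly s) x = (\<Prod>i<s. x + int (Suc i))"
  by (simp add: rising_poly_def poly_prod add.commute)

lemma degree_rising_poly: "degree (rising_poly s) = s"
  unfolding rising_poly_def by (subst degree_prod_eq_sum_degree) auto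

lemma rising_poly_pochhammer: "poly (rising_poly s) x = pochhammer (x + 1) s"
  by (simp add: poly_rising_poly pochhammer_prod lessThan_atLeast0 ac_simps)

text \<open>Both sides are the factorial of \<open>j + s\<close>.\<close>

lemma fact_mult_poly_rising_poly:
  "fact j * poly (rising_poly s) (int j) = fact s * pochhammer (int (Suc s)) j"
proof -
  have "fact j * pochhammer (1 + int j) s = pochhammer 1 (j + s)"
    by (simp add: pochhammer_product'[of 1 j s] pochhammer_fact)
  also have "\<dots> = fact s * pochhammer (1 + int s) j"
    by (subst add.commute) (simp add: pochhammer_product'[of 1 s j] pochhammer_fact)
  finally show ?thesis by (simp add: rising_poly_pochhammer ac_simps)
qed

lemma poly_rising_poly_not_dvd:
  assumes "prime p" "j + s < p" "[x = int j] (mod int p)"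
  shows "\<not> int p dvd poly (rising_poly s) x"
proof
  assume "int p dvd poly (rising_poly s) x"
  then obtain i where i: "i < s" "int p dvd x + int (Suc i)"
    using assms(1) prime_dvd_prod_iff[of "{..<s}" "int p" "\<lambda>i. x + int (Suc i)"]
    by (auto simp: poly_rising_poly)
  then have "int p dvd int j + int (Suc i)"
    using cong_add[OF assms(3) cong_refl[of "int (Suc i)"]] cong_dvd_iff by blast
  then show False using i(1) assms(2) by (auto dest!: zdvd_imp_le)
qed

text \<open>The linear factor of index \<open>p - j - 1\<close> takes the value \<open>p\<close> at
  \<open>j\<close>. Isolating it makes the divisibility by \<open>p\<close> explicit.\<close>

lemma poly_rising_poly_split:
  assumes "j < p" "p \<le> j + s"
  obtains B where "rising_poly s = [:int p - int j, 1:] * B"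
proof -
  have "p - j - 1 < s" and e: "int (Suc (p - j - 1)) = int p - int j" using assms by auto
  then have "rising_poly s = [:int p - int j, 1:] * (\<Prod>i\<in>{..<s} - {p - j - 1}. [:int (Suc i), 1:])"
    unfolding rising_poly_def by (subst prod.remove[of _ "p - j - 1"]) (auto simp del: of_nat_Suc)
  then show thesis by (rule that)
qed

lemma morita_add_coprime:
  assumes "\<And>i. i < k \<Longrightarrow> \<not> p dvd n + i"
  shows "morita p (n + k) = (-1) ^ k * pochhammer (int n) k * morita p n"
  unfolding morita_add pochhammer_prod lessThan_atLeast0 using assms by simp

lemma morita_Suc_less:
  assumes "j < p"
  shows "morita p (Suc j) = - ((-1) ^ j * fact j)"
proof -
  have "morita p (1 + j) = (-1) ^ j * pochhammer (int 1) j * morita p 1"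
    by (rule morita_add_coprime) (use assms in \<open>auto dest: dvd_imp_le\<close>)
  then show ?thesis by (simp add: morita_Suc pochhammer_fact)
qed

text \<open>By \<open>morita_shift_ratio\<close> the shift by \<open>p * k\<close> changes the value
  at \<open>n + j\<close> by the same ratio as the value at \<open>Suc s + j\<close>. There
  \<open>s\<close> uses of the functional equation lead down to \<open>Suc j\<close>, producing the
  polynomial; \<open>j + s < p\<close> ensures that no multiple of \<open>p\<close> is met.\<close>

lemma morita_ratio:
  assumes "prime p" "odd p" "n = Suc s + p * b" "j + s < p"
  shows "[morita p (n + (j + p * k)) * morita p (Suc j) * poly (rising_poly s) (int j) =
          morita p (n + j) * morita p (Suc (j + p * k)) * poly (rising_poly s) (int (j + p * k))] (mod int p ^ 2)"
proof -
  have *: "morita p (Suc s + (j + p * i)) =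
      (-1) ^ s * poly (rising_poly s) (int (j + p * i)) * morita p (Suc (j + p * i))" for i
  proof -
    have "\<not> p dvd Suc (j + p * i) + l" if "l < s" for l
    proof
      assume "p dvd Suc (j + p * i) + l"
      then have "p dvd Suc (j + l) + p * i" by (simp add: ac_simps)
      then have "p dvd Suc (j + l)" using dvd_add_left_iff by (metis dvd_triv_left)
      then show False using assms(4) that by (auto dest: dvd_imp_le)
    qed
    from morita_add_coprime[of s, OF this] show ?thesis
      by (simp add: rising_poly_pochhammer ac_simps)
  qed
  define y where "y = Suc s + j"
  have "[morita p y * (morita p (n + (j + p * k)) * morita p (Suc j) * poly (rising_poly s) (int j)) =
      morita p (y + p * k) * morita p (y + p * b) * (morita p (Suc j) * poly (rising_poly s) (int j))] (mod int p ^ 2)"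
    using cong_scalar_right[OF morita_shift_ratio[OF assms(1,2), of y k b], of "morita p (Suc j) * poly (rising_poly s) (int j)"]
    by (simp add: y_def assms(3) ac_simps)
  also have "morita p (y + p * k) * morita p (y + p * b) * (morita p (Suc j) * poly (rising_poly s) (int j)) =
      morita p y * (morita p (n + j) * morita p (Suc (j + p * k)) * poly (rising_poly s) (int (j + p * k)))"
    using *[of k] *[of 0] by (simp add: y_def assms(3) ac_simps)
  finally show ?thesis by (rule morita_mult_cancel[OF assms(1)])
qed

subsection \<open>Values of the \<open>p\<close>-adic gamma function modulo \<open>p\<^sup>k\<close>\<close>

lemma padic_residue_of_int:
  "padic_residue (of_int z :: 'p :: prime_card padic_int) n = z mod int CARD('p) ^ n"
proof (cases z rule: int_cases2)
  case (nonneg m)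
  then show ?thesis by (simp only: of_int_of_nat_eq padic_residue_of_nat)
next
  case (nonpos m)
  then have "(of_int z :: 'p padic_int) = - of_nat m" by simp
  then show ?thesis
    unfolding nonpos uminus_padic_int.rep_eq padic_residue_of_nat
    by (simp only: uminus_padic_int.rep_eq padic_residue_of_nat mod_minus_eq)
qed

lemma padic_residue_minus:
  "padic_residue (x - y :: 'p :: prime_card padic_int) n =
     (padic_residue x n - padic_residue y n) mod int CARD('p) ^ n"
  unfolding minus_padic_int_def plus_padic_int.rep_eq uminus_padic_int.rep_eq mod_add_right_eq
  by simp

lemma padic_residue_mod_self:
  "padic_residue (x :: 'p :: prime_card padic_int) n mod int CARD('p) ^ n = padic_residue x n"
  by (rule padic_residue_mod) simp

lemma padic_residue_nonneg: "padic_residue (x :: 'p :: prime_card padic_int) n \<ge> 0"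
proof -
  have "int CARD('p) ^ n > 0" using prime_gt_0_nat[OF prime_card[where 'a = 'p]] by simp
  from pos_mod_sign[OF this, of "padic_residue x n"] show ?thesis by (simp add: padic_residue_mod_self)
qed

text \<open>Dividing by the \<open>k\<close>-th power of the prime costs \<open>k\<close> digits of
  precision, so the \<open>n\<close>-th residue of the quotient \<open>f\<close> is read off from
  the residue of \<open>x\<close> at level \<open>k + n\<close>.\<close>

lemma power_dvd_padic_int_iff:
  fixes x :: "'p :: prime_card padic_int"
  shows "of_nat (CARD('p) ^ k) dvd x \<longleftrightarrow> padic_residue x k = 0"
proof
  assume "of_nat (CARD('p) ^ k) dvd x"
  then obtain y where "x = of_nat (CARD('p) ^ k) * y" by blast
  moreover have "padic_residue (of_nat (CARD('p) ^ k) :: 'p padic_int) k = 0"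
    unfolding padic_residue_of_nat by simp
  ultimately show "padic_residue x k = 0" by (simp add: times_padic_int.rep_eq)
next
  assume x: "padic_residue x k = 0"
  let ?q = "int CARD('p)"
  have q0: "?q > 0" using prime_gt_0_nat[OF prime_card[where 'a = 'p]] by simp
  define f where "f n = padic_residue x (k + n) div ?q ^ k" for n
  have split: "padic_residue x (k + n) mod (?q ^ k * ?q ^ m) = ?q ^ k * (f n mod ?q ^ m)" for n m
    using zmod_zmult2_eq[of "?q ^ m" "padic_residue x (k + n)" "?q ^ k"] x
      padic_residue_mod[of k "k + n" x] by (simp add: f_def)
  have "f (Suc n) mod ?q ^ n = f n" for n
  proof -
    have "?q ^ k * (f (Suc n) mod ?q ^ n) = padic_residue x (k + n)"
      using split[of "Suc n" n] padic_residue_mod[of "k + n" "k + Suc n" x] by (simp add: power_add)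
    then show ?thesis
      using q0 nonzero_mult_div_cancel_left[of "?q ^ k" "f (Suc n) mod ?q ^ n"]
      by (simp add: f_def[of n])
  qed
  then have y: "padic_residue (Abs_padic_int f :: 'p padic_int) = f"
    by (intro Abs_padic_int_inverse) simp
  have "x = of_nat (CARD('p) ^ k) * Abs_padic_int f"
  proof (rule padic_int_eqI)
    fix n
    have "padic_residue (of_nat (CARD('p) ^ k) * Abs_padic_int f :: 'p padic_int) n =
        ?q ^ k * f n mod ?q ^ n"
      unfolding times_padic_int.rep_eq padic_residue_of_nat y by (simp add: mod_simps)
    also have "?q ^ k * f n = padic_residue x (k + n)"
      using split[of n n] padic_residue_mod_self[of x "k + n"] y
        padic_residue_mod_self[of "Abs_padic_int f :: 'p padic_int" n] by (simp add: power_add)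
    also have "\<dots> mod ?q ^ n = padic_residue x n" by (rule padic_residue_mod) simp
    finally show "padic_residue x n = padic_residue (of_nat (CARD('p) ^ k) * Abs_padic_int f :: 'p padic_int) n" ..
  qed
  then show "of_nat (CARD('p) ^ k) dvd x" by (metis dvd_triv_left)
qed

lemma power_dvd_padic_diff_iff:
  fixes x y :: "'p :: prime_card padic_int"
  shows "of_nat (CARD('p) ^ k) dvd x - y \<longleftrightarrow> padic_residue x k = padic_residue y k"
  unfolding power_dvd_padic_int_iff padic_residue_minus
  using padic_residue_mod_self[of x k] padic_residue_mod_self[of y k]
    mod_eq_dvd_iff[of "padic_residue x k" "int CARD('p) ^ k" "padic_residue y k"]
  by (simp add: dvd_eq_mod_eq_0)

text \<open>Inverses modulo each prime power are unique, so the arbitrarily chosen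
  \<open>g n\<close> become coherent once reduced.\<close>

lemma padic_unit_exists:
  fixes x :: "'p :: prime_card padic_int"
  assumes "padic_residue x 1 \<noteq> 0"
  shows "\<exists>y. x * y = 1"
proof -
  let ?q = "int CARD('p)"
  have pq: "prime ?q" using prime_card[where 'a = 'p] by simp
  have cop: "coprime (padic_residue x n) (?q ^ n)" for n
  proof (cases "n = 0")
    case False
    then have "padic_residue x n mod ?q = padic_residue x 1"
      using padic_residue_mod[of 1 n x] by simp
    then have "\<not> ?q dvd padic_residue x n" using assms by auto
    then show ?thesis using prime_imp_coprime[OF pq] by (simp add: coprime_commute)
  qed simp
  define g where "g n = (SOME y. [padic_residue x n * y = 1] (mod ?q ^ n))" for n
  have g: "[padic_residue x n * g n = 1] (mod ?q ^ n)" for n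
    unfolding g_def by (rule someI_ex) (use cong_solve_coprime_int[OF cop[of n]] in auto)
  define f where "f n = g n mod ?q ^ n" for n
  have "f (Suc n) mod ?q ^ n = f n" for n
  proof -
    have "[padic_residue x (Suc n) * g (Suc n) = 1] (mod ?q ^ n)"
      using g[of "Suc n"] by (rule cong_dvd_modulus) simp
    moreover have "[padic_residue x (Suc n) = padic_residue x n] (mod ?q ^ n)"
      using padic_residue_mod[of n "Suc n" x] padic_residue_mod_self[of x n] by (simp add: cong_def)
    ultimately have "[padic_residue x n * g (Suc n) = 1] (mod ?q ^ n)"
      by (meson cong_scalar_right cong_sym cong_trans)
    then have "[padic_residue x n * g (Suc n) = padic_residue x n * g n] (mod ?q ^ n)"
      using g[of n] by (meson cong_sym cong_trans)
    then have "[g (Suc n) = g n] (mod ?q ^ n)" using cong_mult_lcancel[OF cop] by blast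
    then show ?thesis by (simp add: f_def cong_def mod_mod_cancel)
  qed
  then have y: "padic_residue (Abs_padic_int f :: 'p padic_int) = f"
    by (intro Abs_padic_int_inverse) simp
  have "x * Abs_padic_int f = 1"
    by (rule padic_int_eqI)
       (use g in \<open>simp add: times_padic_int.rep_eq one_padic_int.rep_eq y f_def mod_simps cong_def\<close>)
  then show ?thesis by blast
qed

text \<open>Agreement of residues is inherited by lower levels, and for distinct points it stops at
  a greatest level \<open>v\<close>, which determines the distance. With the converse bound
  \<open>padic_dist_le\<close>, limits turn into congruences.\<close>

lemma padic_residue_eq_of_dist:
  fixes x y :: "'p :: prime_card padic_int"
  assumes "dist x y < 1 / real CARD('p) ^ k"
  shows "padic_residue x k = padic_residue y k"
proof (cases "x = y")
  case False
  define v where "v = (GREATEST n. padic_residue x n = padic_residue y n)"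
  have down: "padic_residue x n = padic_residue y n"
    if "padic_residue x m = padic_residue y m" "n \<le> m" for n m
    using that by (metis padic_residue_mod)
  obtain b where b: "padic_residue x b \<noteq> padic_residue y b" using False padic_int_eqI by blast
  have "padic_residue x 0 = padic_residue y 0"
    using padic_residue_mod_self[of x 0] padic_residue_mod_self[of y 0] by simp
  then have v: "padic_residue x v = padic_residue y v"
    unfolding v_def by (rule GreatestI_nat[of _ 0 b]) (use down b nle_le in blast)
  have p: "1 < real CARD('p)" using prime_gt_1_nat[OF prime_card[where 'a = 'p]] by simp
  have "1 / real CARD('p) ^ v < 1 / real CARD('p) ^ k"
    using assms False by (simp add: dist_padic_int_def v_def)
  then have "k < v" using p by (simp add: field_simps)
  then show ?thesis using v down by simp
qed simp

lemma padic_dist_le: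
  fixes x y :: "'p :: prime_card padic_int"
  assumes "padic_residue x k = padic_residue y k"
  shows "dist x y \<le> 1 / real CARD('p) ^ k"
proof (cases "x = y")
  case False
  define v where "v = (GREATEST n. padic_residue x n = padic_residue y n)"
  have down: "padic_residue x n = padic_residue y n"
    if "padic_residue x m = padic_residue y m" "n \<le> m" for n m
    using that by (metis padic_residue_mod)
  obtain b where b: "padic_residue x b \<noteq> padic_residue y b" using False padic_int_eqI by blast
  have "k \<le> v"
    unfolding v_def by (rule Greatest_le_nat[of _ k b]) (use assms down b nle_le in blast)+
  moreover have p: "1 < real CARD('p)" using prime_gt_1_nat[OF prime_card[where 'a = 'p]] by simp
  ultimately have "real CARD('p) ^ k \<le> real CARD('p) ^ v" by simp
  then show ?thesis using False p by (simp add: dist_padic_int_def v_def field_simps)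
qed simp

lemma padic_power_small:
  assumes "e > 0"
  obtains k where "k > 0" "1 / real CARD('p :: prime_card) ^ k < e"
proof -
  have p: "1 < real CARD('p)" using prime_gt_1_nat[OF prime_card[where 'a = 'p]] by simp
  obtain k where k: "1 / e < real CARD('p) ^ k" using real_arch_pow[OF p] by blast
  also have "\<dots> \<le> real CARD('p) ^ Suc k" using p by simp
  finally have "1 / real CARD('p) ^ Suc k < e" using assms p by (simp add: field_simps)
  then show thesis by (rule that[rotated]) simp
qed

lemma padic_Gamma_nat_morita:
  "padic_Gamma_nat n = (of_int (morita CARD('p) n) :: 'p :: prime_card padic_int)"
  by (simp add: padic_Gamma_nat_def morita_def)

text \<open>The Morita values at the residues of \<open>x\<close> form a coherent sequence
  \<open>f\<close> by \<open>morita_cong\<close>, and the p-adic integer with these residues is the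
  limit. The value 1 fixed by definition at \<open>x = 0\<close> agrees with
  \<open>f\<close>.\<close>

lemma padic_residue_Gamma:
  fixes x :: "'p :: prime_card padic_int"
  assumes "odd CARD('p)" "k > 0" "[int n = padic_residue x k] (mod int CARD('p) ^ k)"
  shows "padic_residue (padic_Gamma x) k = morita CARD('p) n mod int CARD('p) ^ k"
proof -
  let ?p = "CARD('p)"
  have pp: "prime ?p" by (rule prime_card)
  define f where "f k = morita ?p (nat (padic_residue x k)) mod int ?p ^ k" for k
  have mc: "morita ?p n mod int ?p ^ k = f k"
    if "k > 0" "[int n = padic_residue x k] (mod int ?p ^ k)" for n k
  proof -
    have "[int n = int (nat (padic_residue x k))] (mod int (?p ^ k))"
      using that padic_residue_nonneg[of x k] by simp
    then have "[n = nat (padic_residue x k)] (mod ?p ^ k)" by (simp only: cong_int_iff)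
    from morita_cong[OF pp assms(1) that(1) this] show ?thesis by (simp add: cong_def f_def)
  qed
  show ?thesis
  proof (cases "x = 0")
    case True
    then have "f k = 1 mod int ?p ^ k" by (simp add: f_def zero_padic_int.rep_eq)
    then show ?thesis
      using mc[OF assms(2,3)] True by (simp add: padic_Gamma_def one_padic_int.rep_eq)
  next
    case False
    have "f (Suc n) mod int ?p ^ n = f n" for n
    proof (cases "n = 0")
      case False
      have "[int (nat (padic_residue x (Suc n))) = padic_residue x n] (mod int ?p ^ n)"
        using padic_residue_nonneg[of x "Suc n"] padic_residue_mod[of n "Suc n" x] padic_residue_mod_self[of x n]
        by (simp add: cong_def)
      from mc[OF _ this] False show ?thesis by (simp add: f_def mod_mod_cancel)
    qed (simp add: f_def)
    then have y: "padic_residue (Abs_padic_int f :: 'p padic_int) = f"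
      by (intro Abs_padic_int_inverse) simp
    define F where "F = inf (filtercomap (of_nat :: nat \<Rightarrow> 'p padic_int) (nhds x)) (principal {0<..})"
    have ev: "eventually P F \<longleftrightarrow> (\<exists>e>0. \<forall>n>0. dist (of_nat n) x < e \<longrightarrow> P n)" for P
    proof
      assume "eventually P F"
      then obtain Q where "eventually Q (nhds x)" "\<And>n. Q (of_nat n) \<Longrightarrow> n > 0 \<Longrightarrow> P n"
        by (auto simp: F_def eventually_inf_principal eventually_filtercomap)
      then show "\<exists>e>0. \<forall>n>0. dist (of_nat n) x < e \<longrightarrow> P n"
        unfolding eventually_nhds_metric by blast
    next
      assume "\<exists>e>0. \<forall>n>0. dist (of_nat n) x < e \<longrightarrow> P n"
      then obtain e where e: "e > 0" "\<And>n. n > 0 \<Longrightarrow> dist (of_nat n) x < e \<Longrightarrow> P n" by blast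
      have "eventually (\<lambda>z. dist z x < e) (nhds x)"
        unfolding eventually_nhds_metric using e(1) by blast
      then show "eventually P F"
        unfolding F_def eventually_inf_principal eventually_filtercomap using e(2) by blast
    qed
    \<comment> \<open>Properness of the filter makes the limit unique. The integer \<open>n\<close>
      used here is a residue of \<open>x\<close> increased by a prime power, to make it positive
      without changing its residue.\<close>
    have nb: "F \<noteq> bot"
    proof
      assume "F = bot"
      then have "eventually (\<lambda>_. False) F" by simp
      then obtain e where e: "e > 0" "\<And>n. n > 0 \<Longrightarrow> \<not> dist (of_nat n) x < e" unfolding ev by blast
      obtain k where k: "1 / real ?p ^ k < e" using padic_power_small[OF e(1), where 'p = 'p] by blast
      define n where "n = nat (padic_residue x k) + ?p ^ k"
      have "n > 0" using pp prime_gt_0_nat by (simp add: n_def)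
      moreover have "padic_residue (of_nat n :: 'p padic_int) k = padic_residue x k"
        unfolding padic_residue_of_nat n_def
        using padic_residue_nonneg[of x k] padic_residue_mod_self[of x k] by simp
      ultimately show False using e(2)[of n] padic_dist_le[of "of_nat n" k x] k by simp
    qed
    have "((padic_Gamma_nat :: nat \<Rightarrow> 'p padic_int) \<longlongrightarrow> Abs_padic_int f) F"
    proof (rule tendstoI)
      fix e :: real assume "e > 0"
      then obtain k where k: "k > 0" "1 / real ?p ^ k < e"
        using padic_power_small[where 'p = 'p] by blast
      have "dist (padic_Gamma_nat n) (Abs_padic_int f :: 'p padic_int) < e"
        if "dist (of_nat n) x < 1 / real ?p ^ k" for n
      proof -
        have "int n mod int ?p ^ k = padic_residue x k"
          using padic_residue_eq_of_dist[OF that] by (simp add: padic_residue_of_nat)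
        then have "[int n = padic_residue x k] (mod int ?p ^ k)"
          using padic_residue_mod_self[of x k] by (simp add: cong_def)
        from mc[OF k(1) this]
        have "padic_residue (padic_Gamma_nat n :: 'p padic_int) k = padic_residue (Abs_padic_int f :: 'p padic_int) k"
          by (simp add: padic_Gamma_nat_morita padic_residue_of_int y)
        from padic_dist_le[OF this] k(2) show ?thesis by simp
      qed
      moreover have "1 / real ?p ^ k > 0" using pp prime_gt_0_nat by simp
      ultimately show "eventually (\<lambda>n. dist (padic_Gamma_nat n) (Abs_padic_int f :: 'p padic_int) < e) F"
        unfolding ev by blast
    qed
    from tendsto_Lim[OF nb this] have "padic_Gamma x = Abs_padic_int f"
      using False by (simp add: padic_Gamma_def F_def)
    then show ?thesis using mc[OF assms(2,3)] y by simp
  qed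
qed

subsection \<open>Congruences in \<open>\<rat>\<^sub>p\<close>\<close>

definition padic_integral :: "'p :: prime_card padic \<Rightarrow> bool" where
  "padic_integral x \<longleftrightarrow> x \<in> range to_fract"

definition pcong :: "nat \<Rightarrow> 'p :: prime_card padic \<Rightarrow> 'p padic \<Rightarrow> bool" where
  "pcong k x y \<longleftrightarrow> padic_cong x y (CARD('p) ^ k)"

lemma to_fract_of_nat: "to_fract (of_nat n) = of_nat n"
  by (simp add: to_fract_def of_nat_fract)

lemma to_fract_of_int: "to_fract (of_int n) = of_int n"
  by (cases n rule: int_cases2) (simp_all add: to_fract_of_nat)

text \<open>Turns divisibility in the ring of p-adic integers into an equation in its fraction
  field, where an explicit integral witness can be checked by algebra.\<close>

lemma pcong_iff:
  fixes x y :: "'p :: prime_card padic"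
  shows "pcong k x y \<longleftrightarrow>
    padic_integral y \<and> (\<exists>z. padic_integral z \<and> x = y + of_nat CARD('p) ^ k * z)" (is "?L \<longleftrightarrow> ?R")
proof -
  have P: "to_fract (of_nat (CARD('p) ^ k)) = (of_nat CARD('p) ^ k :: 'p padic)"
    unfolding to_fract_of_nat by simp
  have ?R if ?L
  proof -
    from that obtain a b z where "x = to_fract a" "y = to_fract b"
      and ab: "a - b = of_nat (CARD('p) ^ k) * z"
      by (auto simp: pcong_def padic_cong_def dvd_def simp del: of_nat_power)
    moreover from ab have "a = b + of_nat (CARD('p) ^ k) * z" by (simp add: algebra_simps)
    ultimately show ?R
      using P by (intro conjI exI[of _ "to_fract z"]) (simp_all add: padic_integral_def del: of_nat_power)
  qed
  moreover have ?L if ?R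
  proof -
    from that obtain b z where "y = to_fract b" "x = y + of_nat CARD('p) ^ k * to_fract z"
      by (auto simp: padic_integral_def)
    then have "x = to_fract (b + of_nat (CARD('p) ^ k) * z)" "y = to_fract b"
      using P by (simp_all del: of_nat_power)
    then show ?L unfolding pcong_def padic_cong_def by (metis add_diff_cancel_left' dvd_triv_left)
  qed
  ultimately show ?thesis by blast
qed

lemma padic_integral_of_nat [simp]: "padic_integral (of_nat n)"
  unfolding padic_integral_def by (simp flip: to_fract_of_nat)

lemma padic_integral_of_int [simp]: "padic_integral (of_int n)"
  unfolding padic_integral_def by (simp flip: to_fract_of_int)

lemma padic_integral_0 [simp]: "padic_integral 0" and padic_integral_1 [simp]: "padic_integral 1"
  using padic_integral_of_nat[of 0] padic_integral_of_nat[of 1] by simp_all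

lemma padic_integral_fact [simp]: "padic_integral (fact n)"
  using padic_integral_of_nat[of "fact n"] by simp

lemma padic_integral_to_fract [simp]: "padic_integral (to_fract a)"
  by (simp add: padic_integral_def)

lemma padic_integral_add [simp, intro]: "padic_integral x \<Longrightarrow> padic_integral y \<Longrightarrow> padic_integral (x + y)"
  unfolding padic_integral_def by (auto simp flip: to_fract_add)

lemma padic_integral_mult [simp, intro]: "padic_integral x \<Longrightarrow> padic_integral y \<Longrightarrow> padic_integral (x * y)"
  unfolding padic_integral_def by (auto simp flip: to_fract_mult)

lemma padic_integral_uminus [simp, intro]: "padic_integral x \<Longrightarrow> padic_integral (- x)"
  unfolding padic_integral_def by (auto simp flip: to_fract_uminus)

lemma padic_integral_diff [simp, intro]: "padic_integral x \<Longrightarrow> padic_integral y \<Longrightarrow> padic_integral (x - y)"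
  using padic_integral_add[of x "- y"] by auto

lemma padic_integral_power [simp, intro]: "padic_integral x \<Longrightarrow> padic_integral (x ^ n)"
  by (induction n) auto

lemma padic_integral_prod [simp, intro]: "(\<And>i. i \<in> A \<Longrightarrow> padic_integral (f i)) \<Longrightarrow> padic_integral (prod f A)"
  by (induction A rule: infinite_finite_induct) auto

lemma padic_integral_pochhammer [simp, intro]: "padic_integral x \<Longrightarrow> padic_integral (pochhammer x n)"
  unfolding pochhammer_prod by (intro padic_integral_prod padic_integral_add) auto

lemma pcong_integral:
  assumes "pcong k x y"
  shows "padic_integral x" "padic_integral y"
  using assms by (auto simp: pcong_def padic_cong_def)

lemma pcong_refl [simp, intro]: "padic_integral x \<Longrightarrow> pcong k x x"
  unfolding pcong_iff using padic_integral_0 by force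

lemma pcong_sym: "pcong k x y \<Longrightarrow> pcong k y x"
  unfolding pcong_iff
proof (elim conjE exE, intro conjI)
  fix w assume "padic_integral y" "padic_integral w" "x = y + of_nat CARD('a) ^ k * w"
  then show "padic_integral x" "\<exists>w. padic_integral w \<and> y = x + of_nat CARD('a) ^ k * w"
    by (auto intro!: exI[of _ "- w"])
qed

lemma pcong_trans [trans]: "pcong k x y \<Longrightarrow> pcong k y z \<Longrightarrow> pcong k x z"
  unfolding pcong_iff
proof (elim conjE exE, intro conjI)
  fix w w' assume "padic_integral w" "x = y + of_nat CARD('a) ^ k * w"
    "padic_integral w'" "y = z + of_nat CARD('a) ^ k * w'"
  then show "\<exists>w. padic_integral w \<and> x = z + of_nat CARD('a) ^ k * w"
    by (intro exI[of _ "w + w'"]) (auto simp: algebra_simps)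
qed auto

lemma pcong_add: "pcong k x y \<Longrightarrow> pcong k x' y' \<Longrightarrow> pcong k (x + x') (y + y')"
  unfolding pcong_iff
proof (elim conjE exE, intro conjI)
  fix z z' assume z: "padic_integral z" "x = y + of_nat CARD('a) ^ k * z"
    "padic_integral z'" "x' = y' + of_nat CARD('a) ^ k * z'"
  then show "\<exists>z. padic_integral z \<and> x + x' = y + y' + of_nat CARD('a) ^ k * z"
    by (intro exI[of _ "z + z'"]) (auto simp: algebra_simps)
qed auto

lemma pcong_mult: "pcong k x y \<Longrightarrow> pcong k x' y' \<Longrightarrow> pcong k (x * x') (y * y')"
  unfolding pcong_iff
proof (elim conjE exE, intro conjI)
  fix z z' assume z: "padic_integral y" "padic_integral y'"
    "padic_integral z" "x = y + of_nat CARD('a) ^ k * z"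
    "padic_integral z'" "x' = y' + of_nat CARD('a) ^ k * z'"
  have "padic_integral (y * z' + z * y' + of_nat CARD('a) ^ k * z * z')"
    using z by (intro padic_integral_add padic_integral_mult padic_integral_power) auto
  then show "\<exists>z. padic_integral z \<and> x * x' = y * y' + of_nat CARD('a) ^ k * z"
    using z(4,6) by (intro exI[of _ "y * z' + z * y' + of_nat CARD('a) ^ k * z * z'"]) (auto simp: algebra_simps)
qed auto

lemma pcong_uminus: "pcong k x y \<Longrightarrow> pcong k (- x) (- y)"
  using pcong_mult[OF pcong_refl[of "-1" k], of x y] by simp

lemma pcong_diff: "pcong k x y \<Longrightarrow> pcong k x' y' \<Longrightarrow> pcong k (x - x') (y - y')"
  using pcong_add[of k x y "- x'" "- y'"] pcong_uminus[of k x' y'] by simp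

lemma pcong_sum: "(\<And>i. i \<in> A \<Longrightarrow> pcong k (f i) (g i)) \<Longrightarrow> pcong k (sum f A) (sum g A)"
  by (induction A rule: infinite_finite_induct) (auto intro: pcong_add)

lemma pcong_prod: "(\<And>i. i \<in> A \<Longrightarrow> pcong k (f i) (g i)) \<Longrightarrow> pcong k (prod f A) (prod g A)"
  by (induction A rule: infinite_finite_induct) (auto intro: pcong_mult)

lemma pcong_pochhammer: "pcong k x y \<Longrightarrow> pcong k (pochhammer x n) (pochhammer y n)"
  unfolding pochhammer_prod by (intro pcong_prod pcong_add) auto

text \<open>Gains one power of the prime: a quantity with an explicit factor \<open>CARD('p)\<close>
  need only be known modulo the prime.\<close>

lemma pcong_scale:
  assumes "pcong k x y"
  shows "pcong (Suc k) (of_nat CARD('p :: prime_card) * x) (of_nat CARD('p) * (y :: 'p padic))"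
proof -
  from assms obtain z where z: "padic_integral y" "padic_integral z" "x = y + of_nat CARD('p) ^ k * z"
    unfolding pcong_iff by blast
  then have "of_nat CARD('p) * x = of_nat CARD('p) * y + of_nat CARD('p) ^ Suc k * z"
    by (simp add: algebra_simps)
  then show ?thesis unfolding pcong_iff using z by auto
qed

lemma pcong_weaken:
  assumes "pcong k x y" "l \<le> k"
  shows "pcong l x y"
proof -
  from assms(1) obtain a b where *: "x = to_fract a" "y = to_fract b" "of_nat (CARD('a) ^ k) dvd a - b"
    by (auto simp: pcong_def padic_cong_def)
  have "of_nat (CARD('a) ^ l) dvd (of_nat (CARD('a) ^ k) :: 'a padic_int)"
    using assms(2) by (simp add: le_imp_power_dvd)
  then show ?thesis unfolding pcong_def padic_cong_def using * dvd_trans by blast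
qed

lemma pcong_of_int:
  assumes "[a = b] (mod int CARD('p) ^ k)"
  shows "pcong k (of_int a :: 'p :: prime_card padic) (of_int b)"
proof -
  from assms obtain z where "a = b + int CARD('p) ^ k * z"
    using cong_iff_lin[of b a "int CARD('p) ^ k"] by (auto simp: cong_sym_eq mult.commute)
  then have "(of_int a :: 'p padic) = of_int b + of_nat CARD('p) ^ k * of_int z" by simp
  then show ?thesis unfolding pcong_iff using padic_integral_of_int by blast
qed

section \<open>Units of the p-adic integers and congruences between quotients\<close>

definition padic_unit :: "'p :: prime_card padic \<Rightarrow> bool" where
  "padic_unit x \<longleftrightarrow> padic_integral x \<and> padic_integral (inverse x) \<and> x \<noteq> 0"

lemma padic_unitD:
  assumes "padic_unit x"
  shows "padic_integral x" "padic_integral (inverse x)" "x \<noteq> 0"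
  using assms by (auto simp: padic_unit_def)

lemma padic_unit_1 [simp]: "padic_unit 1"
  by (simp add: padic_unit_def)

lemma padic_unit_mult: "padic_unit x \<Longrightarrow> padic_unit y \<Longrightarrow> padic_unit (x * y)"
  by (auto simp: padic_unit_def)

lemma padic_unit_power: "padic_unit x \<Longrightarrow> padic_unit (x ^ n)"
  by (induction n) (auto intro: padic_unit_mult)

lemma padic_unit_to_fract:
  fixes a :: "'p :: prime_card padic_int"
  assumes "padic_residue a 1 \<noteq> 0"
  shows "padic_unit (to_fract a)"
proof -
  obtain b where "a * b = 1" using padic_unit_exists[OF assms] by blast
  then have e: "to_fract a * to_fract b = 1" using to_fract_mult[of a b] by simp
  then have "inverse (to_fract a) = to_fract b" by (rule inverse_unique)
  then show ?thesis using e by (auto simp: padic_unit_def padic_integral_def)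
qed

lemma padic_unit_of_int:
  assumes "\<not> int CARD('p) dvd n"
  shows "padic_unit (of_int n :: 'p :: prime_card padic)"
  unfolding to_fract_of_int[symmetric]
  by (rule padic_unit_to_fract) (use assms in \<open>auto simp: padic_residue_of_int\<close>)

lemma padic_unit_pcong:
  fixes x y :: "'p :: prime_card padic"
  assumes "pcong k x (of_int n)" "k > 0" "\<not> int CARD('p) dvd n"
  shows "padic_unit x"
proof -
  have "pcong 1 x (of_int n)" using assms pcong_weaken[of k x _ 1] by simp
  then obtain a b where ab: "x = to_fract a" "of_int n = (to_fract b :: 'p padic)"
    "of_nat (CARD('p) ^ 1) dvd a - b"
    unfolding pcong_def padic_cong_def by blast
  then have "b = of_int n" by (metis to_fract_of_int to_fract_eq_iff)
  then have "padic_residue a 1 = n mod int CARD('p)"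
    using ab(3) unfolding power_dvd_padic_diff_iff by (simp add: padic_residue_of_int)
  then have "padic_residue a 1 \<noteq> 0" using assms(3) by (simp add: dvd_eq_mod_eq_0)
  then show ?thesis unfolding ab(1) by (rule padic_unit_to_fract)
qed

lemma padic_unit_fact:
  assumes "j < CARD('p)"
  shows "padic_unit (fact j :: 'p :: prime_card padic)"
proof -
  have "\<not> CARD('p) dvd fact j"
    using prime_dvd_fact_iff[OF prime_card[where 'a = 'p], of j] assms by simp
  then have "\<not> int CARD('p) dvd int (fact j)" by (simp only: int_dvd_int_iff simp_thms)
  from padic_unit_of_int[OF this] have "padic_unit (of_nat (fact j) :: 'p padic)"
    by (simp only: of_int_of_nat_eq)
  then show ?thesis by simp
qed

lemma padic_integral_divide [simp, intro]: "padic_integral x \<Longrightarrow> padic_unit y \<Longrightarrow> padic_integral (x / y)"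
  unfolding divide_inverse padic_unit_def by auto

lemma pcong_divide:
  assumes "pcong k x y" "pcong k x' y'" "padic_unit x'" "padic_unit y'"
  shows "pcong k (x / x') (y / y')"
proof -
  have *: "padic_integral (inverse x')" "padic_integral (inverse y')" "x' \<noteq> 0" "y' \<noteq> 0"
    using assms(3,4) by (auto simp: padic_unit_def)
  have "pcong k (inverse x' * (y' * inverse y')) (inverse x' * (x' * inverse y'))"
    using * assms(2) by (intro pcong_mult pcong_refl pcong_sym[of _ x' y']) auto
  then have "pcong k (inverse x') (inverse y')" using * by (simp add: field_simps)
  then show ?thesis unfolding divide_inverse by (intro pcong_mult assms(1))
qed

text \<open>The hypothesis makes \<open>of_rat r\<close> integral, so the definite description in
  \<open>padic_int_of_rat\<close> has its unique witness and \<open>padic_residue_Gamma\<close>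
  applies.\<close>

lemma pcong_Gamma_rat:
  fixes r :: rat
  assumes "odd CARD('p :: prime_card)" "k > 0" "pcong k (of_rat r :: 'p padic) (of_nat n)"
  shows "pcong k (padic_Gamma_rat r :: 'p padic) (of_int (morita CARD('p) n))"
proof -
  obtain a b where ab: "of_rat r = (to_fract a :: 'p padic)" "of_nat n = (to_fract b :: 'p padic)"
    "of_nat (CARD('p) ^ k) dvd a - b"
    using assms(3) unfolding pcong_def padic_cong_def by blast
  have b: "b = of_nat n" using ab(2) by (metis to_fract_of_nat to_fract_eq_iff)
  have a: "padic_int_of_rat r = a"
    unfolding padic_int_of_rat_def ab(1) by (rule the_equality) auto
  have "padic_residue a k = int n mod int CARD('p) ^ k"
    using ab(3) unfolding power_dvd_padic_diff_iff b padic_residue_of_nat .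
  then have "[int n = padic_residue a k] (mod int CARD('p) ^ k)" by (simp add: cong_def)
  from padic_residue_Gamma[OF assms(1,2) this]
  have "of_nat (CARD('p) ^ k) dvd padic_Gamma a - of_int (morita CARD('p) n)"
    unfolding power_dvd_padic_diff_iff by (simp add: padic_residue_of_int)
  then show ?thesis
    unfolding a pcong_def padic_cong_def by (metis to_fract_of_int)
qed

lemma pcong_nat_exists:
  fixes x :: "'p :: prime_card padic"
  assumes "padic_integral x"
  obtains n :: nat where "pcong k x (of_nat n)"
proof -
  obtain a where a: "x = to_fract a" using assms by (auto simp: padic_integral_def)
  define n where "n = nat (padic_residue a k)"
  have "padic_residue a k = padic_residue (of_nat n :: 'p padic_int) k"
    unfolding padic_residue_of_nat n_def
    using padic_residue_nonneg[of a k] padic_residue_mod_self[of a k] by simp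
  then have "pcong k x (of_nat n)"
    unfolding pcong_def padic_cong_def a power_dvd_padic_diff_iff[symmetric] by (metis to_fract_of_nat)
  then show thesis by (rule that)
qed

subsection \<open>Quotients of gamma values\<close>

text \<open>The shift \<open>s\<close> is \<open>0\<close> or \<open>1\<close>, namely \<open>- \<lfloor>m - j / (p - 1)\<rfloor>\<close>.\<close>

definition gamma_quot :: "nat \<Rightarrow> nat \<Rightarrow> rat \<Rightarrow> 'p :: prime_card padic" where
  "gamma_quot s j m =
     padic_Gamma_rat (of_nat j / (of_nat CARD('p) - 1)) *
     padic_Gamma_rat (m - of_nat j / (of_nat CARD('p) - 1) + of_nat s) / padic_Gamma_rat m"

lemma padic_unit_card_minus_1: "padic_unit (of_nat CARD('p) - 1 :: 'p :: prime_card padic)"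
proof -
  have "\<not> int CARD('p) dvd int CARD('p) - 1"
    using prime_gt_1_nat[OF prime_card[where 'a = 'p]]
    by (metis dvd_diffD dvd_refl diff_diff_cancel dvd_minus_iff dvd_diff_right_iff zdvd1_eq of_nat_1_eq_iff abs_of_nat less_irrefl)
  from padic_unit_of_int[OF this] show ?thesis by simp
qed

lemma padic_unit_morita: "padic_unit (of_int (morita CARD('p) n) :: 'p :: prime_card padic)"
proof (rule padic_unit_of_int)
  show "\<not> int CARD('p) dvd morita CARD('p) n"
    using coprime_morita[OF prime_card[where 'a = 'p], of n] prime_card_int[where 'a = 'p]
    by (metis coprime_absorb_right coprime_commute not_prime_unit)
qed

lemma padic_unit_Gamma_rat:
  assumes "odd CARD('p :: prime_card)" "k > 0" "pcong k (of_rat r :: 'p padic) (of_nat n)"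
  shows "padic_unit (padic_Gamma_rat r :: 'p padic)"
proof (rule padic_unit_pcong[OF pcong_Gamma_rat[OF assms] assms(2)])
  show "\<not> int CARD('p) dvd morita CARD('p) n"
    using coprime_morita[OF prime_card[where 'a = 'p], of n] prime_card_int[where 'a = 'p]
    by (metis coprime_absorb_right coprime_commute not_prime_unit)
qed

text \<open>Since \<open>(p + 1) * (p - 2) < p ^ 2\<close>, the natural-number subtraction
  \<open>p ^ 2 - (j + p * j)\<close> does not truncate.\<close>

lemma shifted_index_less:
  fixes p :: nat
  assumes "j + 2 \<le> p"
  shows "j + p * j < p ^ 2"
proof -
  have "Suc p * j \<le> Suc p * (p - 2)" using assms by (intro mult_left_mono) auto
  also have "\<dots> < p ^ 2" using assms by (cases p; cases "p - 1") (auto simp: power2_eq_square algebra_simps)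
  finally show ?thesis by simp
qed

text \<open>Modulo \<open>p ^ 2\<close> the inverse of \<open>p - 1\<close> is
  \<open>-(1 + p)\<close>; adding \<open>p ^ 2\<close> makes the representative a natural
  number.\<close>

lemma pcong_index:
  assumes "j + 2 \<le> CARD('p)"
  shows "pcong 2 (of_rat (of_nat j / (of_nat CARD('p) - 1)) :: 'p :: prime_card padic)
           (of_nat (CARD('p) ^ 2 - (j + CARD('p) * j)))"
proof -
  define P where "P = (of_nat CARD('p) :: 'p padic)"
  have u: "padic_unit (P - 1)" using padic_unit_card_minus_1[where 'p = 'p] by (simp add: P_def)
  have "of_nat (CARD('p) ^ 2 - (j + CARD('p) * j)) = P ^ 2 - of_nat j - P * of_nat j"
    using shifted_index_less[OF assms] by (simp add: P_def of_nat_diff)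
  \<comment> \<open>The witness comes from \<open>1 = P ^ 2 - (P - 1) * (P + 1)\<close>, multiplied
    by \<open>j / (P - 1)\<close>.\<close>
  moreover have "of_nat j / (P - 1) = (P ^ 2 - of_nat j - P * of_nat j) + P ^ 2 * (of_nat j / (P - 1) - 1)"
    using padic_unitD(3)[OF u] by (simp add: field_simps power2_eq_square)
  moreover have "of_rat (of_nat j / (of_nat CARD('p) - 1)) = of_nat j / (P - 1)"
    by (simp add: P_def of_rat_divide of_rat_diff)
  moreover have "padic_integral (of_nat j / (P - 1) - 1)" using u by simp
  ultimately show ?thesis
    unfolding pcong_iff P_def[symmetric] using padic_integral_of_nat by metis
qed

lemma pcong_shift_index:
  assumes "j + 2 \<le> CARD('p)" "pcong 2 (of_rat m :: 'p :: prime_card padic) (of_nat n)"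
  shows "pcong 2 (of_rat (m - of_nat j / (of_nat CARD('p) - 1) + of_nat s) :: 'p padic)
           (of_nat (n + (j + CARD('p) * j) + s))"
proof -
  define x where "x = j + CARD('p) * j"
  have x: "x < CARD('p) ^ 2" using shifted_index_less[OF assms(1)] by (simp add: x_def)
  have "pcong 2 (of_rat (m - of_nat j / (of_nat CARD('p) - 1) + of_nat s) :: 'p padic)
      (of_nat n - of_nat (CARD('p) ^ 2 - x) + of_nat s)"
    unfolding of_rat_add of_rat_diff of_rat_of_nat_eq x_def
    using assms pcong_index[OF assms(1)] by (intro pcong_add pcong_diff) auto
  also have "pcong 2 (of_nat n - of_nat (CARD('p) ^ 2 - x) + of_nat s :: 'p padic) (of_nat (n + x + s))"
  proof -
    have "(of_nat n - of_nat (CARD('p) ^ 2 - x) + of_nat s :: 'p padic) =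
        of_nat (n + x + s) + of_nat CARD('p) ^ 2 * (- 1)"
      using x by (simp add: of_nat_diff)
    then show ?thesis unfolding pcong_iff using padic_integral_uminus[OF padic_integral_1] padic_integral_of_nat by blast
  qed
  finally show ?thesis by (simp add: x_def)
qed

text \<open>The reflection formula moves the gamma value at \<open>j / (p - 1)\<close> into the
  denominator as a Morita value at \<open>x + 1\<close>, where \<open>x = j + p * j\<close>. Its
  sign exponent is \<open>x - x div p = p * j\<close>, which has the parity of
  \<open>j\<close>.\<close>

lemma gamma_quot_morita:
  assumes "odd CARD('p :: prime_card)" "j + 2 \<le> CARD('p)" "pcong 2 (of_rat m :: 'p padic) (of_nat n)"
  shows "pcong 2 (gamma_quot s j m :: 'p padic)
    (- ((-1) ^ j) * of_int (morita CARD('p) (n + (j + CARD('p) * j) + s)) /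
      (of_int (morita CARD('p) (Suc (j + CARD('p) * j))) * of_int (morita CARD('p) n)))"
proof -
  define p where "p = CARD('p)"
  define x where "x = j + p * j"
  define M where "M n = (of_int (morita p n) :: 'p padic)" for n
  have M: "padic_unit (M n)" for n unfolding M_def p_def by (rule padic_unit_morita)
  have p0: "p > 0" using assms(2) by (simp add: p_def)
  have "x div p = j" using assms(2) by (simp add: x_def p_def)
  then have "x - x div p = p * j" by (simp add: x_def)
  then have "(-1 :: int) ^ (x - x div p) = (-1) ^ j"
    using assms(1) by (simp add: p_def power_mult)
  then have "[morita p (p ^ 2 - x) * morita p (Suc x) = - ((-1) ^ j)] (mod int p ^ 2)"
    using morita_reflection[of p x] prime_card[where 'a = 'p] assms(1) shifted_index_less[OF assms(2)]
    by (simp add: x_def p_def)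
  from pcong_of_int[OF this[unfolded p_def]]
  have "pcong 2 (M (p ^ 2 - x) * M (Suc x)) (- ((-1) ^ j))"
    by (simp add: M_def p_def)
  then have "pcong 2 (M (p ^ 2 - x) * M (Suc x) / M (Suc x)) (- ((-1) ^ j) / M (Suc x))"
    using M padic_unitD(1)[OF M] by (intro pcong_divide) auto
  then have 1: "pcong 2 (M (p ^ 2 - x)) (- ((-1) ^ j) / M (Suc x))"
    using padic_unitD(3)[OF M] by simp
  note t = pcong_index[OF assms(2)]
  note G = pcong_Gamma_rat[OF assms(1), of 2]
  have "pcong 2 (padic_Gamma_rat (of_nat j / (of_nat CARD('p) - 1)) :: 'p padic) (M (p ^ 2 - x))"
    using G[OF _ t] by (simp add: M_def p_def x_def)
  from pcong_trans[OF this 1]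
  have 2: "pcong 2 (padic_Gamma_rat (of_nat j / (of_nat CARD('p) - 1)) :: 'p padic) (- ((-1) ^ j) / M (Suc x))" .
  have 3: "pcong 2 (padic_Gamma_rat (m - of_nat j / (of_nat CARD('p) - 1) + of_nat s) :: 'p padic) (M (n + x + s))"
    using G[OF _ pcong_shift_index[OF assms(2,3), of s]] by (simp add: M_def p_def x_def)
  have 4: "pcong 2 (padic_Gamma_rat m :: 'p padic) (M n)"
    using G[OF _ assms(3)] by (simp add: M_def p_def)
  have "pcong 2 (gamma_quot s j m :: 'p padic) (- ((-1) ^ j) / M (Suc x) * M (n + x + s) / M n)"
    unfolding gamma_quot_def
    using padic_unit_Gamma_rat[OF assms(1) _ assms(3)] M
    by (intro pcong_divide pcong_mult 2 3 4) auto
  then show ?thesis by (simp add: M_def p_def x_def)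
qed

text \<open>\<open>morita_ratio\<close> replaces the argument \<open>x = j + p * j\<close> by
  \<open>j\<close> at the cost of a quotient of polynomial values. The remaining Morita values then
  become a rising factorial and \<open>fact j\<close>, since \<open>j + s < p\<close> excludes
  multiples of \<open>p\<close>.\<close>

lemma gamma_quot_pcong_2:
  assumes "odd CARD('p :: prime_card)" "j + 2 \<le> CARD('p)"
    and n: "pcong 2 (of_rat m :: 'p padic) (of_nat (Suc s + CARD('p) * b))" and s: "j + s < CARD('p)"
  shows "pcong 2 (gamma_quot 0 j m :: 'p padic)
    ((-1) ^ j * (pochhammer (of_rat m) j / fact j) *
     (of_int (poly (rising_poly s) (int (j + CARD('p) * j))) / of_int (poly (rising_poly s) (int j))))"
proof -
  define p where "p = CARD('p)"
  have pp: "prime p" and op: "odd p" using prime_card[where 'a = 'p] assms(1) by (simp_all add: p_def)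
  define x where "x = j + p * j"
  define n where "n = Suc s + p * b"
  define M where "M n = (of_int (morita p n) :: 'p padic)" for n
  define A where "A x = (of_int (poly (rising_poly s) (int x)) :: 'p padic)" for x
  have M: "padic_unit (M n)" for n unfolding M_def p_def by (rule padic_unit_morita)
  have Aj: "padic_unit (A j)"
    unfolding A_def using poly_rising_poly_not_dvd[OF pp, of j s "int j"] s
    by (intro padic_unit_of_int) (simp add: p_def)
  have nz: "M k \<noteq> 0" "A j \<noteq> 0" for k using padic_unitD(3)[OF M] padic_unitD(3)[OF Aj] .
  have fj: "padic_unit (fact j :: 'p padic)" using s by (intro padic_unit_fact) simp
  have "[morita p (n + x) * morita p (Suc j) * poly (rising_poly s) (int j) =
         morita p (n + j) * morita p (Suc x) * poly (rising_poly s) (int x)] (mod int p ^ 2)"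
    unfolding x_def using s by (intro morita_ratio[OF pp op]) (auto simp: n_def p_def)
  from pcong_of_int[OF this[unfolded p_def]]
  have "pcong 2 (M (n + x) * M (Suc j) * A j) (M (n + j) * M (Suc x) * A x)"
    by (simp add: M_def A_def p_def)
  then have "pcong 2 (M (n + x) * M (Suc j) * A j / (M (Suc x) * M n * M (Suc j) * A j))
      (M (n + j) * M (Suc x) * A x / (M (Suc x) * M n * M (Suc j) * A j))"
    using M Aj by (intro pcong_divide pcong_refl padic_unit_mult padic_unitD(1)) auto
  then have 1: "pcong 2 (M (n + x) / (M (Suc x) * M n)) (M (n + j) / M n / M (Suc j) * (A x / A j))"
    using nz by (simp add: field_simps)
  have "M (n + j) = (-1) ^ j * pochhammer (of_nat n) j * M n"
  proof -
    have "\<not> p dvd n + i" if "i < j" for i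
    proof
      assume "p dvd n + i"
      then have "p dvd (Suc s + i) + p * b" by (simp add: n_def ac_simps)
      then have "p dvd Suc s + i" using dvd_add_left_iff by (metis dvd_triv_left)
      then show False using that s by (auto dest: dvd_imp_le simp: p_def)
    qed
    then have "morita p (n + j) = (-1) ^ j * pochhammer (int n) j * morita p n"
      by (rule morita_add_coprime)
    then show ?thesis by (simp add: M_def pochhammer_of_int[symmetric])
  qed
  moreover have "M (Suc j) = - ((-1) ^ j * fact j)"
    using morita_Suc_less[of j p] s by (simp add: M_def p_def)
  ultimately have 2: "M (n + j) / M n / M (Suc j) = - (pochhammer (of_nat n) j / fact j)"
    using nz padic_unitD(3)[OF fj] by (simp add: field_simps)
  have "pcong 2 (gamma_quot 0 j m :: 'p padic) (- ((-1) ^ j) * (M (n + x) / (M (Suc x) * M n)))"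
    using gamma_quot_morita[OF assms(1,2) n, of 0] by (simp add: M_def p_def x_def n_def)
  also have "pcong 2 \<dots> (- ((-1) ^ j) * (- (pochhammer (of_nat n) j / fact j) * (A x / A j)))"
    using 1 unfolding 2 by (intro pcong_mult) auto
  also have "pcong 2 \<dots> (- ((-1) ^ j) * (- (pochhammer (of_rat m) j / fact j) * (A x / A j)))"
    using n Aj fj unfolding n_def p_def A_def
    by (intro pcong_mult pcong_uminus pcong_divide pcong_pochhammer pcong_refl padic_integral_divide) (auto intro: pcong_sym)
  finally show ?thesis by (simp add: A_def x_def p_def mult.assoc)
qed

text \<open>Modulo \<open>p\<close> the shift by \<open>p * j\<close> disappears by periodicity.
  This precision is enough for the terms that carry a factor \<open>p\<close> of their own.\<close>

lemma gamma_quot_pcong_1: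
  assumes "odd CARD('p :: prime_card)" "j + 2 \<le> CARD('p)" "pcong 2 (of_rat m :: 'p padic) (of_nat n)"
  shows "pcong 1 (gamma_quot s j m :: 'p padic)
    (of_int (morita CARD('p) (n + j + s)) / (of_int (morita CARD('p) n) * fact j))"
proof -
  define p where "p = CARD('p)"
  have pp: "prime p" and op: "odd p" using prime_card[where 'a = 'p] assms(1) by (simp_all add: p_def)
  define x where "x = j + p * j"
  define M where "M n = (of_int (morita p n) :: 'p padic)" for n
  have M: "padic_unit (M n)" for n unfolding M_def p_def by (rule padic_unit_morita)
  have per: "pcong 1 (M (k + p * j)) (M k)" for k
    using morita_cong[OF pp op, of 1 "k + p * j" k] pcong_of_int[where 'p = 'p and k = 1]
    by (simp add: M_def p_def cong_def)
  have "pcong 1 (gamma_quot s j m :: 'p padic) (- ((-1) ^ j) * M (n + x + s) / (M (Suc x) * M n))"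
    using pcong_weaken[OF gamma_quot_morita[OF assms, of s], of 1] by (simp add: M_def p_def x_def)
  also have "pcong 1 \<dots> (- ((-1) ^ j) * M (n + j + s) / (M (Suc j) * M n))"
    using per[of "n + j + s"] per[of "Suc j"] M
    by (intro pcong_divide pcong_mult padic_unit_mult) (auto simp: x_def ac_simps intro: padic_unitD(1))
  also have "M (Suc j) = - ((-1) ^ j * fact j)"
    using morita_Suc_less[of j p] assms(2) by (simp add: M_def p_def)
  finally show ?thesis by (simp add: M_def p_def mult.commute)
qed

text \<open>Morita's function skips multiples of \<open>p\<close>, so the result is a rising
  factorial deprived of its factors divisible by \<open>p\<close>.\<close>

lemma gamma_quot_0_pcong_1:
  assumes "odd CARD('p :: prime_card)" "j + 2 \<le> CARD('p)" "pcong 2 (of_rat m :: 'p padic) (of_nat n)"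
  shows "pcong 1 (gamma_quot 0 j m :: 'p padic)
    ((-1) ^ j * (\<Prod>i | i < j \<and> \<not> CARD('p) dvd n + i. of_rat m + of_nat i) / fact j)"
proof -
  define p where "p = CARD('p)"
  let ?S = "{i. i < j \<and> \<not> p dvd n + i}"
  have fj: "padic_unit (fact j :: 'p padic)" using assms(2) by (intro padic_unit_fact) simp
  have "(\<Prod>i<j. if p dvd n + i then 1 else int (n + i)) = (\<Prod>i\<in>?S. int (n + i))"
    by (rule prod.mono_neutral_cong_right) auto
  then have "morita p (n + j) = (-1) ^ j * (\<Prod>i\<in>?S. int (n + i)) * morita p n"
    by (simp add: morita_add)
  then have e: "(of_int (morita p (n + j)) :: 'p padic) =
      (-1) ^ j * (\<Prod>i\<in>?S. of_nat n + of_nat i) * of_int (morita p n)"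
    by simp
  have "pcong 1 (gamma_quot 0 j m :: 'p padic) (of_int (morita p (n + j)) / (of_int (morita p n) * fact j))"
    using gamma_quot_pcong_1[OF assms, of 0] by (simp add: p_def)
  also have "of_int (morita p (n + j)) / (of_int (morita p n) * fact j) =
      (-1) ^ j * (\<Prod>i\<in>?S. of_nat n + of_nat i) / (fact j :: 'p padic)"
    unfolding e using padic_unitD(3)[OF padic_unit_morita[where 'p = 'p, of n]] by (simp add: p_def)
  also have "pcong 1 \<dots> ((-1) ^ j * (\<Prod>i\<in>?S. of_rat m + of_nat i) / fact j)"
    using pcong_weaken[OF assms(3), of 1] fj
    by (intro pcong_divide pcong_mult pcong_prod pcong_add) (auto intro: pcong_sym)
  finally show ?thesis by (simp add: p_def)
qed

lemma gamma_quot_1_pcong_1: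
  assumes "odd CARD('p :: prime_card)" "j + 2 \<le> CARD('p)" "pcong 2 (of_rat m :: 'p padic) (of_nat n)"
    and "\<not> CARD('p) dvd n + j"
  shows "pcong 1 (gamma_quot 1 j m :: 'p padic) (- (of_rat m + of_nat j) * gamma_quot 0 j m)"
proof -
  define Q where "Q = (of_int (morita CARD('p) (n + j)) / (of_int (morita CARD('p) n) * fact j) :: 'p padic)"
  have fj: "padic_unit (fact j :: 'p padic)" using assms(2) by (intro padic_unit_fact) simp
  have "pcong 1 (gamma_quot 1 j m :: 'p padic) (- (of_nat n + of_nat j) * Q)"
    using gamma_quot_pcong_1[OF assms(1-3), of 1] assms(4) by (simp add: morita_Suc Q_def)
  also have "pcong 1 \<dots> (- (of_rat m + of_nat j) * gamma_quot 0 j m)"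
    using pcong_weaken[OF assms(3), of 1] gamma_quot_pcong_1[OF assms(1-3), of 0]
    by (intro pcong_mult pcong_uminus pcong_add) (auto intro: pcong_sym simp: Q_def)
  finally show ?thesis .
qed

lemma padic_integral_gamma_quot:
  assumes "odd CARD('p :: prime_card)" "j + 2 \<le> CARD('p)" "pcong 2 (of_rat m :: 'p padic) (of_nat n)"
  shows "padic_integral (gamma_quot s j m :: 'p padic)"
  using pcong_integral(1)[OF gamma_quot_morita[OF assms, of s]] .

subsection \<open>Termwise comparison\<close>

text \<open>The contribution of one parameter to a term of \<open>padic_G\<close>: each parameter
  receives one of the gamma values at \<open>t\<close>, while the signs are left to
  \<open>G_term\<close>.\<close>

definition G_factor :: "nat \<Rightarrow> rat \<Rightarrow> 'p :: prime_card padic" where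
  "G_factor j m =
     (let t = of_nat j / (of_nat CARD('p) - 1)
      in padic_Gamma_rat t * (padic_Gamma_rat (frac (m - t)) / padic_Gamma_rat m *
           (- of_nat CARD('p)) powi (- \<lfloor>m - t\<rfloor>)))"

lemma G_factor_le:
  assumes "of_nat j / (of_nat CARD('p) - 1) \<le> m" "m < 1"
  shows "(G_factor j m :: 'p :: prime_card padic) = gamma_quot 0 j m"
proof -
  define t :: rat where "t = of_nat j / (of_nat CARD('p) - 1)"
  have "t \<ge> 0"
    using prime_gt_1_nat[OF prime_card[where 'a = 'p]] by (simp add: t_def)
  then have "\<lfloor>m - t\<rfloor> = 0" using assms by (intro floor_unique) (auto simp: t_def[symmetric])
  then show ?thesis by (simp add: G_factor_def Let_def frac_def gamma_quot_def flip: t_def)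
qed

text \<open>Here the floor is -1, which yields one factor \<open>- of_nat CARD('p)\<close> and the
  shift by 1 in the fractional part.\<close>

lemma G_factor_gt:
  assumes "j + 2 \<le> CARD('p)" "m < of_nat j / (of_nat CARD('p) - 1)" "m > 0"
  shows "(G_factor j m :: 'p :: prime_card padic) = - of_nat CARD('p) * gamma_quot 1 j m"
proof -
  define t :: rat where "t = of_nat j / (of_nat CARD('p) - 1)"
  have "j + 1 < CARD('p)" using assms(1) by simp
  then have "(of_nat (j + 1) :: rat) < of_nat CARD('p)" by (simp only: of_nat_less_iff)
  then have "of_nat j < (of_nat CARD('p) - 1 :: rat)" by simp
  then have "t < 1" by (simp add: t_def field_simps)
  then have "\<lfloor>m - t\<rfloor> = -1" using assms by (intro floor_unique) (auto simp: t_def[symmetric])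
  then show ?thesis by (simp add: G_factor_def Let_def frac_def gamma_quot_def flip: t_def)
qed

text \<open>Since \<open>z\<close> is multiplied by the prime, it may be replaced by a natural
  number congruent to it modulo the prime.\<close>

lemma pcong_shifted_nat_exists:
  assumes "of_rat m = of_nat (Suc s) + of_nat CARD('p) * (z :: 'p :: prime_card padic)" "padic_integral z"
  obtains b where "pcong 2 (of_rat m :: 'p padic) (of_nat (Suc s + CARD('p) * b))"
proof -
  obtain b where "pcong 1 z (of_nat b)" using pcong_nat_exists[OF assms(2)] by blast
  then have "pcong (Suc 1) (of_nat CARD('p) * z) (of_nat CARD('p) * of_nat b)" by (rule pcong_scale)
  then have "pcong 2 (of_rat m :: 'p padic) (of_nat (Suc s) + of_nat CARD('p) * of_nat b)"
    unfolding assms(1) by (intro pcong_add) (auto simp: numeral_2_eq_2)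
  then show thesis by (intro that[of b]) (simp add: add.assoc)
qed

lemma pcong_1_intro:
  assumes "padic_integral y" "padic_integral z" "x = y + of_nat CARD('p) * (z :: 'p :: prime_card padic)"
  shows "pcong 1 x y"
  unfolding pcong_iff using assms by auto

lemma pcong_2_0:
  assumes "padic_integral z" "x = of_nat CARD('p) ^ 2 * (z :: 'p :: prime_card padic)"
  shows "pcong 2 x 0"
  unfolding pcong_iff using assms by auto

lemma pcong_scale_2:
  assumes "pcong 1 x (y :: 'p :: prime_card padic)"
  shows "pcong 2 (of_nat CARD('p) * x) (of_nat CARD('p) * y)"
  using pcong_scale[OF assms] by (simp add: numeral_2_eq_2)

text \<open>Treats both residue classes of the prime at once. Here \<open>r\<close> is the floor of
  \<open>(p - 1) / d\<close>, and \<open>c\<close> is the one of \<open>1/d\<close>,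
  \<open>1 - 1/d\<close> with \<open>c + r = p / d\<close>, hence the parameter whose rising
  factorial meets the prime at index \<open>r\<close>. Which of the two it is matters only for the
  floors.\<close>

locale G_parameters =
  fixes prime_type :: "'p :: prime_card itself" and d :: int and r h :: nat and c c' :: rat
  assumes card_eq: "CARD('p) = 2 * h + 1"
    and d_ge: "d \<ge> 2" and d_not_dvd: "\<not> int CARD('p) dvd d"
    and r_le_h: "r \<le> h"
    and le_r_iff: "j \<le> r \<longleftrightarrow> d * int j \<le> int CARD('p) - 1"
    and c_eq: "c + of_nat r = of_nat CARD('p) / of_int d"
    and c'_eq: "c' = 1 - c"
    and c_cases: "c = 1 / of_int d \<or> c' = 1 / of_int d"
begin

abbreviation P :: "'p padic" where "P \<equiv> of_nat CARD('p)"

definition F_term :: "nat \<Rightarrow> 'p padic" where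
  "F_term j = pochhammer (of_rat (1/2)) j * pochhammer (of_rat c) j * pochhammer (of_rat c') j / fact j ^ 3"

definition G_term :: "nat \<Rightarrow> 'p padic" where
  "G_term j = (-1) ^ j * (G_factor j (1/2) * G_factor j c * G_factor j c')"

definition R :: "int poly" where
  "R = rising_poly h * rising_poly (CARD('p) - 1 - r) * rising_poly r"

text \<open>The value of \<open>R\<close> at 0, written with factorials below the prime so that it
  is visibly a unit.\<close>

definition R0 :: "'p padic" where
  "R0 = fact h * fact (CARD('p) - 1 - r) * fact r"

lemma odd_card: "odd CARD('p)"
  by (simp add: card_eq)

lemma h_pos: "h > 0"
  using card_eq prime_gt_1_nat[OF prime_card[where 'a = 'p]] by simp

lemma unit_d: "padic_unit (of_int d :: 'p padic)"
  using d_not_dvd by (rule padic_unit_of_int)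

lemma unit_2: "padic_unit (2 :: 'p padic)"
proof -
  have "\<not> int CARD('p) dvd 2" using card_eq h_pos by (auto dest: zdvd_imp_le)
  from padic_unit_of_int[OF this] show ?thesis by simp
qed

lemma integral_halves [simp]: "padic_integral (1 / 2 :: 'p padic)" "padic_integral (1 / of_int d :: 'p padic)"
  using unit_d unit_2 by auto

lemma unit_R0: "padic_unit R0"
  unfolding R0_def using card_eq r_le_h by (intro padic_unit_mult padic_unit_fact) auto

lemma of_rat_half: "(of_rat (1/2) :: 'p padic) = 1 / 2"
  by (simp add: of_rat_divide)

lemma of_rat_c: "(of_rat c :: 'p padic) + of_nat r = P / of_int d"
proof -
  have "(of_rat (c + of_nat r) :: 'p padic) = of_rat (of_nat CARD('p) / of_int d)" by (simp only: c_eq)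
  then show ?thesis by (simp add: of_rat_add of_rat_divide)
qed

lemma of_rat_c': "(of_rat c' :: 'p padic) = 1 - of_rat c"
  by (simp add: c'_eq of_rat_diff)

text \<open>This equation and its analogues for \<open>c\<close> and \<open>c'\<close> bring the
  parameters into the shape \<open>Suc s + P * z\<close>, where \<open>s\<close> is the degree of
  the matching factor of \<open>R\<close>.\<close>

lemma of_rat_half_eq: "(of_rat (1/2) :: 'p padic) = of_nat (Suc h) + P * (- (1 / 2))"
  unfolding of_rat_half by (simp add: card_eq field_simps)

lemma of_rat_c_eq: "(of_rat c :: 'p padic) = of_nat (Suc (CARD('p) - 1 - r)) + P * (1 / of_int d - 1)"
proof -
  have "Suc (CARD('p) - 1 - r) = CARD('p) - r" "r \<le> CARD('p)" using card_eq r_le_h by auto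
  then have e: "(of_nat (Suc (CARD('p) - 1 - r)) :: 'p padic) = P - of_nat r"
    by (simp only: of_nat_diff)
  show ?thesis unfolding e using of_rat_c by (simp add: algebra_simps)
qed

lemma of_rat_c'_eq: "(of_rat c' :: 'p padic) = of_nat (Suc r) + P * (- (1 / of_int d))"
  unfolding of_rat_c' using of_rat_c by (simp add: algebra_simps)

lemma residue_half: obtains b where "pcong 2 (of_rat (1/2) :: 'p padic) (of_nat (Suc h + CARD('p) * b))"
  by (rule pcong_shifted_nat_exists[OF of_rat_half_eq]) simp_all

lemma residue_c: obtains b where "pcong 2 (of_rat c :: 'p padic) (of_nat (Suc (CARD('p) - 1 - r) + CARD('p) * b))"
  by (rule pcong_shifted_nat_exists[OF of_rat_c_eq]) simp_all

lemma residue_c': obtains b where "pcong 2 (of_rat c' :: 'p padic) (of_nat (Suc r + CARD('p) * b))"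
  by (rule pcong_shifted_nat_exists[OF of_rat_c'_eq]) simp_all

lemma pcong_1_parameters:
  "pcong 1 (of_rat (1/2) :: 'p padic) (of_nat (Suc h))"
  "pcong 1 (of_rat c :: 'p padic) (of_nat (Suc (CARD('p) - 1 - r)))"
  "pcong 1 (of_rat c' :: 'p padic) (of_nat (Suc r))"
  by (rule pcong_1_intro[OF _ _ of_rat_half_eq] pcong_1_intro[OF _ _ of_rat_c_eq] pcong_1_intro[OF _ _ of_rat_c'_eq];
      simp del: of_nat_Suc)+

lemma integral_of_rat [simp]:
  "padic_integral (of_rat (1/2) :: 'p padic)" "padic_integral (of_rat c :: 'p padic)"
  "padic_integral (of_rat c' :: 'p padic)"
  using pcong_1_parameters[THEN pcong_integral(1)] .

lemma pochhammer_rising_poly: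
  assumes "j < CARD('p)"
  shows "pochhammer (of_nat (Suc s)) j / fact j = of_int (poly (rising_poly s) (int j)) / (fact s :: 'p padic)"
proof -
  have "(of_int (fact j * poly (rising_poly s) (int j)) :: 'p padic) =
      of_int (fact s * pochhammer (int (Suc s)) j)"
    by (simp only: fact_mult_poly_rising_poly)
  then have "(fact j :: 'p padic) * of_int (poly (rising_poly s) (int j)) = fact s * pochhammer (of_nat (Suc s)) j"
    by (simp add: pochhammer_of_int[symmetric])
  then show ?thesis by (simp add: field_simps)
qed

lemma index_le_half: "of_nat j / (of_nat CARD('p) - 1) \<le> (1/2 :: rat) \<longleftrightarrow> j \<le> h"
  using h_pos by (simp add: card_eq field_simps)

lemma index_le_d: "of_nat j / (of_nat CARD('p) - 1) \<le> (1 / of_int d :: rat) \<longleftrightarrow> j \<le> r"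
proof -
  have "of_nat j / (of_nat CARD('p) - 1) \<le> (1 / of_int d :: rat) \<longleftrightarrow>
      (of_int (d * int j) :: rat) \<le> of_int (int CARD('p) - 1)"
    using h_pos d_ge by (simp add: card_eq field_simps)
  also have "\<dots> \<longleftrightarrow> j \<le> r" unfolding of_int_le_iff le_r_iff ..
  finally show ?thesis .
qed

lemma d_bounds: "1 / of_int d > (0::rat)" "1 / of_int d \<le> (1/2::rat)"
  using d_ge by (simp_all add: field_simps)

lemma c_bounds:
  "1 / of_int d \<le> c" "c \<le> 1 - 1 / of_int d" "1 / of_int d \<le> c'" "c' \<le> 1 - 1 / of_int d"
  by (rule disjE[OF c_cases]; use c'_eq d_bounds in linarith)+

lemma F_term_ratio:
  assumes "j < CARD('p)"
  shows "pcong 1 (F_term j) (of_int (poly R (int j)) / R0)"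
proof -
  have "F_term j = (pochhammer (of_rat (1/2)) j / fact j) * (pochhammer (of_rat c) j / fact j) *
      (pochhammer (of_rat c') j / fact j)"
    by (simp add: F_term_def power3_eq_cube)
  also have "pcong 1 \<dots> ((pochhammer (of_nat (Suc h)) j / fact j) *
      (pochhammer (of_nat (Suc (CARD('p) - 1 - r))) j / fact j) * (pochhammer (of_nat (Suc r)) j / fact j))"
    by (intro pcong_mult pcong_divide pcong_pochhammer pcong_1_parameters pcong_refl padic_integral_fact padic_unit_fact assms)
  also have "\<dots> = of_int (poly R (int j)) / R0"
    unfolding pochhammer_rising_poly[OF assms] by (simp add: R_def R0_def)
  finally show ?thesis .
qed

text \<open>All three floors are 0 and no factor \<open>P\<close> occurs, so \<open>G_term j\<close>
  is \<open>F_term j\<close> times the quotient of the values of \<open>R\<close> at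
  \<open>x = j + p * j\<close> and at \<open>j\<close>. Expanding \<open>R\<close> at
  \<open>j\<close> to first order leaves the derivative term.\<close>

lemma term_low:
  assumes j: "j \<le> r" "j + 2 \<le> CARD('p)"
  shows "pcong 2 ((1 + P) * G_term j) (F_term j + P * (of_int (poly (pderiv (pCons 0 R)) (int j)) / R0))"
proof -
  define x where "x = j + CARD('p) * j"
  define A where "A s x = (of_int (poly (rising_poly s) (int x)) :: 'p padic)" for s x
  define Rx where "Rx x = (of_int (poly R (int x)) :: 'p padic)" for x
  define D where "D = (of_int (poly (pderiv R) (int j)) :: 'p padic)"
  have Rx: "Rx x = A h x * A (CARD('p) - 1 - r) x * A r x" for x by (simp add: Rx_def A_def R_def)
  obtain b1 where b1: "pcong 2 (of_rat (1/2) :: 'p padic) (of_nat (Suc h + CARD('p) * b1))" by (rule residue_half)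
  obtain b2 where b2: "pcong 2 (of_rat c :: 'p padic) (of_nat (Suc (CARD('p) - 1 - r) + CARD('p) * b2))" by (rule residue_c)
  obtain b3 where b3: "pcong 2 (of_rat c' :: 'p padic) (of_nat (Suc r + CARD('p) * b3))" by (rule residue_c')
  have small: "j + h < CARD('p)" "j + (CARD('p) - 1 - r) < CARD('p)" "j + r < CARD('p)"
    using j r_le_h card_eq h_pos by auto
  have unit_A: "padic_unit (A s j)" if "j + s < CARD('p)" for s
    unfolding A_def using poly_rising_poly_not_dvd[OF prime_card[where 'a = 'p] that, of "int j"]
    by (intro padic_unit_of_int) simp
  have unit_R: "padic_unit (Rx j)"
    unfolding Rx using small by (intro padic_unit_mult unit_A)
  have t: "of_nat j / (of_nat CARD('p) - 1) \<le> (1/2 :: rat)" "of_nat j / (of_nat CARD('p) - 1) \<le> (1/ of_int d :: rat)"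
    using index_le_half[of j] index_le_d[of j] j r_le_h by auto
  have tc: "of_nat j / (of_nat CARD('p) - 1) \<le> c" "c < 1" "of_nat j / (of_nat CARD('p) - 1) \<le> c'" "c' < 1"
    using t d_bounds c_bounds by linarith+
  have "G_term j = (-1) ^ j * (gamma_quot 0 j (1/2) * gamma_quot 0 j c * gamma_quot 0 j c')"
    unfolding G_term_def using t tc by (simp add: G_factor_le)
  also have "pcong 2 \<dots> ((-1) ^ j *
      (((-1) ^ j * (pochhammer (of_rat (1/2)) j / fact j) * (A h x / A h j)) *
       ((-1) ^ j * (pochhammer (of_rat c) j / fact j) * (A (CARD('p) - 1 - r) x / A (CARD('p) - 1 - r) j)) *
       ((-1) ^ j * (pochhammer (of_rat c') j / fact j) * (A r x / A r j))))"
    unfolding A_def x_def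
    by (intro pcong_mult pcong_refl gamma_quot_pcong_2[OF odd_card j(2) b1 small(1)]
        gamma_quot_pcong_2[OF odd_card j(2) b2 small(2)] gamma_quot_pcong_2[OF odd_card j(2) b3 small(3)]) simp
  \<comment> \<open>Three signs come from the gamma quotients and the fourth from
    \<open>G_term\<close>.\<close>
  also have "\<dots> = ((-1) ^ j) ^ 4 * (F_term j * (Rx x / Rx j))"
    by (simp only: F_term_def Rx power3_eq_cube power4_eq_xxxx divide_inverse inverse_mult_distrib ac_simps)
  also have "((-1) ^ j) ^ 4 = (1 :: 'p padic)" by (simp flip: power_mult)
  finally have G1: "pcong 2 (G_term j) (F_term j * (Rx x / Rx j))" by simp
  have intF: "padic_integral (F_term j)"
    using small(1) unfolding F_term_def
    by (intro padic_integral_divide padic_integral_mult padic_integral_pochhammer padic_unit_power padic_unit_fact) auto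
  \<comment> \<open>Exact in the leading term, this quotient may be replaced by
    \<open>1 / R0\<close> wherever it is multiplied by \<open>P\<close>.\<close>
  define \<tau> where "\<tau> = F_term j / Rx j"
  have int_\<tau>: "padic_integral \<tau>" unfolding \<tau>_def using intF unit_R by simp
  have F_\<tau>: "F_term j = \<tau> * Rx j" using padic_unitD(3)[OF unit_R] by (simp add: \<tau>_def)
  have "pcong 1 (F_term j / Rx j) (Rx j / R0 / Rx j)"
    using F_term_ratio[of j] small(1) unit_R padic_unitD(1)[OF unit_R] unfolding Rx_def
    by (intro pcong_divide) auto
  then have \<tau>: "pcong 1 \<tau> (1 / R0)" using padic_unitD(3)[OF unit_R] by (simp add: \<tau>_def)
  have "[poly R (int j + int CARD('p) * int j) = poly R (int j) + int CARD('p) * int j * poly (pderiv R) (int j)]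
      (mod int CARD('p) ^ 2)"
    by (rule cong_dvd_modulus[OF poly_add_cong_pderiv]) (simp add: power_mult_distrib)
  from pcong_of_int[OF this] have Rx_cong: "pcong 2 (Rx x) (Rx j + P * of_nat j * D)"
    by (simp add: Rx_def D_def x_def)
  have "pcong 2 ((1 + P) * G_term j) ((1 + P) * (\<tau> * Rx x))"
    using G1 by (intro pcong_mult) (auto simp: \<tau>_def)
  also have "pcong 2 \<dots> ((1 + P) * (\<tau> * (Rx j + P * of_nat j * D)))"
    using int_\<tau> by (intro pcong_mult Rx_cong) auto
  also have "pcong 2 \<dots> (F_term j + P * (\<tau> * (Rx j + of_nat j * D)))"
    unfolding pcong_iff
  proof (intro conjI exI)
    show "padic_integral (\<tau> * of_nat j * D)" "padic_integral (F_term j + P * (\<tau> * (Rx j + of_nat j * D)))"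
      using int_\<tau> intF by (simp_all add: D_def Rx_def)
    show "(1 + P) * (\<tau> * (Rx j + P * of_nat j * D)) =
        F_term j + P * (\<tau> * (Rx j + of_nat j * D)) + P ^ 2 * (\<tau> * of_nat j * D)"
      unfolding F_\<tau> by (simp add: algebra_simps power2_eq_square)
  qed
  also have "pcong 2 \<dots> (F_term j + P * (1 / R0 * (Rx j + of_nat j * D)))"
    using intF \<tau> by (intro pcong_add pcong_scale_2 pcong_mult pcong_refl) (auto simp: D_def Rx_def)
  \<comment> \<open>The factor \<open>1 + P\<close> supplies the summand \<open>Rx j\<close>, the
    Taylor expansion supplies \<open>j * D\<close>; together they are the product rule for
    \<open>pCons 0 R\<close>, the polynomial \<open>x R\<close>.\<close>
  also have "1 / R0 * (Rx j + of_nat j * D) = of_int (poly (pderiv (pCons 0 R)) (int j)) / R0"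
    by (simp add: pderiv_pCons Rx_def D_def)
  finally show ?thesis .
qed

text \<open>For \<open>r < j\<close> the middle factor of \<open>R\<close> contains a linear
  polynomial with value \<open>CARD('p)\<close> at \<open>j\<close> and derivative 1. Modulo the
  prime, differentiation therefore just removes it.\<close>

lemma rising_poly_c_split:
  assumes "r < j" "j < CARD('p)"
  obtains B where "rising_poly (CARD('p) - 1 - r) = [:int CARD('p) - int j, 1:] * B"
    "[poly (pderiv (pCons 0 R)) (int j) =
       int j * (poly (rising_poly h) (int j) * poly B (int j) * poly (rising_poly r) (int j))] (mod int CARD('p))"
proof -
  obtain B where B: "rising_poly (CARD('p) - 1 - r) = [:int CARD('p) - int j, 1:] * B"
  proof -
    have "j < CARD('p)" "CARD('p) \<le> j + (CARD('p) - 1 - r)" using assms by auto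
    from poly_rising_poly_split[OF this] that show thesis by blast
  qed
  define Q where "Q = pCons 0 (rising_poly h * B * rising_poly r)"
  have "pCons 0 R = [:0, 1:] * R" by simp
  also have "\<dots> = [:int CARD('p) - int j, 1:] * ([:0, 1:] * (rising_poly h * B * rising_poly r))"
    unfolding R_def B by (simp only: ac_simps)
  also have "\<dots> = [:int CARD('p) - int j, 1:] * Q" by (simp add: Q_def)
  finally have "poly (pderiv (pCons 0 R)) (int j) = int CARD('p) * poly (pderiv Q) (int j) + poly Q (int j)"
    by (simp only: pderiv_mult poly_add poly_mult) (simp add: pderiv_pCons)
  then have "[poly (pderiv (pCons 0 R)) (int j) = poly Q (int j)] (mod int CARD('p))"
    by (simp add: cong_iff_dvd_diff)
  then show thesis by (intro that[OF B]) (simp add: Q_def)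
qed

definition c_rest :: "nat \<Rightarrow> 'p padic" where
  "c_rest j = (\<Prod>i\<in>{..<j} - {r}. of_rat c + of_nat i)"

lemma pochhammer_c:
  assumes "r < j"
  shows "pochhammer (of_rat c) j = P / of_int d * c_rest j"
proof -
  have "pochhammer (of_rat c :: 'p padic) j = (\<Prod>i<j. of_rat c + of_nat i)"
    by (simp add: pochhammer_prod lessThan_atLeast0)
  also have "\<dots> = (of_rat c + of_nat r) * c_rest j"
    unfolding c_rest_def using assms by (subst prod.remove[of _ r]) auto
  finally show ?thesis by (simp only: of_rat_c)
qed

lemma integral_c_rest [simp]: "padic_integral (c_rest j)"
  unfolding c_rest_def by auto

text \<open>What is left of \<open>F_term j\<close>, for \<open>r < j\<close>, after removing the
  factor \<open>P / d\<close> that comes from \<open>of_rat c + of_nat r\<close>.\<close>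

definition V :: "nat \<Rightarrow> 'p padic" where
  "V j = pochhammer (of_rat (1/2)) j * c_rest j * pochhammer (of_rat c') j / fact j ^ 3"

lemma F_term_V: "r < j \<Longrightarrow> F_term j = P / of_int d * V j"
  by (simp add: F_term_def V_def pochhammer_c)

lemma integral_V: "j < CARD('p) \<Longrightarrow> padic_integral (V j)"
  unfolding V_def
  by (intro padic_integral_divide padic_integral_mult padic_integral_pochhammer padic_unit_power padic_unit_fact) auto

text \<open>Removing the factor with index \<open>r\<close> from the rising factorial corresponds to
  removing the linear factor from \<open>R\<close>, and the remaining factors agree modulo the prime
  as in \<open>F_term_ratio\<close>.\<close>

lemma V_pderiv:
  assumes "r < j" "j < CARD('p)"
  shows "pcong 1 (of_int (poly (pderiv (pCons 0 R)) (int j)) / R0) (of_nat j * V j)"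
proof -
  let ?s = "CARD('p) - 1 - r"
  obtain B where B: "rising_poly ?s = [:int CARD('p) - int j, 1:] * B"
    "[poly (pderiv (pCons 0 R)) (int j) =
       int j * (poly (rising_poly h) (int j) * poly B (int j) * poly (rising_poly r) (int j))] (mod int CARD('p))"
    using rising_poly_c_split[OF assms] by blast
  define C where "C = (\<Prod>i\<in>{..<j} - {r}. (of_nat (Suc ?s) + of_nat i :: 'p padic))"
  have "Suc ?s + r = CARD('p)" using card_eq r_le_h by auto
  then have Sr: "(of_nat (Suc ?s) + of_nat r :: 'p padic) = P" by (metis of_nat_add)
  have "pochhammer (of_nat (Suc ?s) :: 'p padic) j = (\<Prod>i<j. of_nat (Suc ?s) + of_nat i)"
    by (simp add: pochhammer_prod lessThan_atLeast0)
  also have "\<dots> = P * C"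
    unfolding C_def using assms by (subst prod.remove[of _ r]) (auto simp only: Sr finite_lessThan lessThan_iff)
  finally have "P * (C / fact j) = of_int (poly (rising_poly ?s) (int j)) / fact ?s"
    using pochhammer_rising_poly[OF assms(2), of ?s] by simp
  also have "\<dots> = P * (of_int (poly B (int j)) / fact ?s)"
  proof -
    have "poly (rising_poly ?s) (int j) = int CARD('p) * poly B (int j)"
      unfolding B(1) by (simp add: algebra_simps)
    then show ?thesis by simp
  qed
  \<comment> \<open>This is an exact equation, not a congruence, so \<open>P\<close> can be
    cancelled without loss of precision.\<close>
  finally have "P * (C / fact j) = P * (of_int (poly B (int j)) / fact ?s)" .
  moreover have "P \<noteq> 0" by simp
  ultimately have C: "C / fact j = of_int (poly B (int j)) / fact ?s"
    using mult_left_cancel by blast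
  have "V j = (pochhammer (of_rat (1/2)) j / fact j) * (c_rest j / fact j) * (pochhammer (of_rat c') j / fact j)"
    by (simp add: V_def power3_eq_cube)
  also have "pcong 1 \<dots> ((pochhammer (of_nat (Suc h)) j / fact j) * (C / fact j) * (pochhammer (of_nat (Suc r)) j / fact j))"
    unfolding c_rest_def C_def
    by (intro pcong_mult pcong_divide pcong_pochhammer pcong_1_parameters pcong_refl padic_integral_fact
        padic_unit_fact assms pcong_prod pcong_add padic_integral_of_nat)
  also have "\<dots> = of_int (poly (rising_poly h) (int j) * poly B (int j) * poly (rising_poly r) (int j)) / R0"
    unfolding pochhammer_rising_poly[OF assms(2)] C by (simp add: R0_def)
  finally have V: "pcong 1 (V j) (of_int (poly (rising_poly h) (int j) * poly B (int j) * poly (rising_poly r) (int j)) / R0)" .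
  have "pcong 1 (of_int (poly (pderiv (pCons 0 R)) (int j)) / R0)
     (of_int (int j * (poly (rising_poly h) (int j) * poly B (int j) * poly (rising_poly r) (int j))) / R0)"
    using B(2) unit_R0 padic_unitD(1)[OF unit_R0] by (intro pcong_divide pcong_of_int) auto
  also have "of_int (int j * (poly (rising_poly h) (int j) * poly B (int j) * poly (rising_poly r) (int j))) / R0 =
      of_nat j * (of_int (poly (rising_poly h) (int j) * poly B (int j) * poly (rising_poly r) (int j)) / R0)"
    by simp
  also have "pcong 1 \<dots> (of_nat j * V j)"
    using V by (intro pcong_mult pcong_sym[OF V]) auto
  finally show ?thesis .
qed

text \<open>Exactly the parameter equal to \<open>1/d\<close> has floor -1, giving
  \<open>G_term j\<close> one factor \<open>P\<close>; gamma quotients modulo the prime then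
  suffice. The result is \<open>P * (1/d + j) * V j\<close>, whose part with \<open>1/d\<close> is
  \<open>F_term j\<close> and whose part with \<open>j\<close> is the derivative term.\<close>

lemma term_mid:
  assumes j: "r < j" "j \<le> h" "j + 2 \<le> CARD('p)"
  shows "pcong 2 ((1 + P) * G_term j) (F_term j + P * (of_int (poly (pderiv (pCons 0 R)) (int j)) / R0))"
proof -
  let ?s = "CARD('p) - 1 - r"
  have jp: "j < CARD('p)" using j by simp
  obtain b1 where b1: "pcong 2 (of_rat (1/2) :: 'p padic) (of_nat (Suc h + CARD('p) * b1))" by (rule residue_half)
  obtain b2 where b2: "pcong 2 (of_rat c :: 'p padic) (of_nat (Suc ?s + CARD('p) * b2))" by (rule residue_c)
  obtain b3 where b3: "pcong 2 (of_rat c' :: 'p padic) (of_nat (Suc r + CARD('p) * b3))" by (rule residue_c')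
  have dvd_iff: "CARD('p) dvd k + CARD('p) * b + i \<longleftrightarrow> CARD('p) dvd k + i" for k b i
  proof -
    have "k + CARD('p) * b + i = (k + i) + CARD('p) * b" by simp
    then show ?thesis by (metis dvd_add_left_iff dvd_triv_left)
  qed
  have nd: "\<not> CARD('p) dvd k" if "0 < k" "k < CARD('p)" for k using that by (auto dest: dvd_imp_le)
  have nd1: "\<not> CARD('p) dvd Suc h + CARD('p) * b1 + i" if "i < j" for i
    unfolding dvd_iff by (rule nd) (use that j card_eq in auto)
  have nd3: "\<not> CARD('p) dvd Suc r + CARD('p) * b3 + i" if "i \<le> j" for i
    unfolding dvd_iff by (rule nd) (use that j card_eq in auto)
  \<comment> \<open>The residue of \<open>c\<close> is \<open>CARD('p) - r\<close>, so the gamma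
    quotient skips exactly the index missing from \<open>c_rest\<close>.\<close>
  have nd2: "CARD('p) dvd Suc ?s + CARD('p) * b2 + i \<longleftrightarrow> i = r" if "i \<le> j" for i
  proof -
    consider "i < r" | "i = r" | "i > r" by linarith
    then show ?thesis
    proof cases
      case 1
      then have "\<not> CARD('p) dvd Suc ?s + i" by (intro nd) (use card_eq r_le_h in auto)
      then show ?thesis using 1 unfolding dvd_iff by simp
    next
      case 2
      then have "Suc ?s + i = CARD('p)" using card_eq r_le_h by auto
      then show ?thesis using 2 unfolding dvd_iff by simp
    next
      case 3
      then have "Suc ?s + i = CARD('p) + (i - r)" using card_eq r_le_h by auto
      moreover have "\<not> CARD('p) dvd i - r" by (intro nd) (use 3 that jp in auto)
      ultimately have "\<not> CARD('p) dvd Suc ?s + i" by (metis dvd_add_right_iff dvd_refl)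
      then show ?thesis using 3 unfolding dvd_iff by simp
    qed
  qed
  have full: "(\<Prod>i<j. of_rat m + of_nat i) = pochhammer (of_rat m :: 'p padic) j" for m
    by (simp add: pochhammer_prod lessThan_atLeast0)
  have "{i. i < j \<and> \<not> CARD('p) dvd Suc h + CARD('p) * b1 + i} = {..<j}" using nd1 by auto
  with gamma_quot_0_pcong_1[OF odd_card j(3) b1]
  have E1: "pcong 1 (gamma_quot 0 j (1/2)) ((-1) ^ j * pochhammer (of_rat (1/2) :: 'p padic) j / fact j)"
    by (simp only: full)
  have "{i. i < j \<and> \<not> CARD('p) dvd Suc r + CARD('p) * b3 + i} = {..<j}" using nd3 by auto
  with gamma_quot_0_pcong_1[OF odd_card j(3) b3]
  have E3: "pcong 1 (gamma_quot 0 j c') ((-1) ^ j * pochhammer (of_rat c' :: 'p padic) j / fact j)"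
    by (simp only: full)
  have "{i. i < j \<and> \<not> CARD('p) dvd Suc ?s + CARD('p) * b2 + i} = {..<j} - {r}" using nd2 by auto
  with gamma_quot_0_pcong_1[OF odd_card j(3) b2]
  have E2: "pcong 1 (gamma_quot 0 j c) ((-1) ^ j * c_rest j / fact j)"
    by (simp only: c_rest_def)
  have S2: "pcong 1 (- gamma_quot 1 j c :: 'p padic) ((of_rat c + of_nat j) * gamma_quot 0 j c)"
    using pcong_uminus[OF gamma_quot_1_pcong_1[OF odd_card j(3) b2]] nd2[of j] j(1)
    by (simp only: mult_minus_left minus_minus)
  have S3: "pcong 1 (- gamma_quot 1 j c' :: 'p padic) ((of_rat c' + of_nat j) * gamma_quot 0 j c')"
    using pcong_uminus[OF gamma_quot_1_pcong_1[OF odd_card j(3) b3 nd3[OF order_refl]]]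
    by (simp only: mult_minus_left minus_minus)
  have t: "of_nat j / (of_nat CARD('p) - 1) \<le> (1/2 :: rat)" "(1 / of_int d :: rat) < of_nat j / (of_nat CARD('p) - 1)"
    using index_le_half[of j] index_le_d[of j] j by auto
  define E where "E = gamma_quot 0 j (1/2) * gamma_quot 0 j c * (gamma_quot 0 j c' :: 'p padic)"
  have dd: "(of_rat (1 / of_int d) :: 'p padic) = 1 / of_int d" by (simp add: of_rat_divide)
  have ig: "padic_integral (gamma_quot s j (1/2) :: 'p padic)" "padic_integral (gamma_quot s j c :: 'p padic)"
    "padic_integral (gamma_quot s j c' :: 'p padic)" for s
    using padic_integral_gamma_quot[OF odd_card j(3) b1] padic_integral_gamma_quot[OF odd_card j(3) b2]
      padic_integral_gamma_quot[OF odd_card j(3) b3] by simp_all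
  \<comment> \<open>The shifted quotient contributes its parameter plus \<open>j\<close>, and that
    parameter is \<open>1/d\<close> whether it is \<open>c\<close> or \<open>c'\<close>; so the two
    cases give the same formula.\<close>
  have G: "pcong 2 (G_term j) (P * ((-1) ^ j * (1 / of_int d + of_nat j) * E))"
    using c_cases
  proof
    assume c: "c = 1 / of_int d"
    then have b: "of_nat j / (of_nat CARD('p) - 1) \<le> c'" "c' < 1" "c < of_nat j / (of_nat CARD('p) - 1)" "c > 0"
      using t d_bounds c_bounds c'_eq by linarith+
    have "G_term j = P * ((-1) ^ j * (gamma_quot 0 j (1/2) * (- gamma_quot 1 j c) * gamma_quot 0 j c'))"
      unfolding G_term_def using t(1) b by (simp add: G_factor_le G_factor_gt[OF j(3)])
    also have "pcong 2 \<dots> (P * ((-1) ^ j * (gamma_quot 0 j (1/2) * ((of_rat c + of_nat j) * gamma_quot 0 j c) * gamma_quot 0 j c')))"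
      by (intro pcong_scale_2 pcong_mult S2 pcong_refl ig) simp
    finally show ?thesis unfolding c dd E_def by (simp add: ac_simps)
  next
    assume c': "c' = 1 / of_int d"
    then have b: "of_nat j / (of_nat CARD('p) - 1) \<le> c" "c < 1" "c' < of_nat j / (of_nat CARD('p) - 1)" "c' > 0"
      using t d_bounds c_bounds c'_eq by linarith+
    have "G_term j = P * ((-1) ^ j * (gamma_quot 0 j (1/2) * gamma_quot 0 j c * (- gamma_quot 1 j c')))"
      unfolding G_term_def using t(1) b by (simp add: G_factor_le G_factor_gt[OF j(3)])
    also have "pcong 2 \<dots> (P * ((-1) ^ j * (gamma_quot 0 j (1/2) * gamma_quot 0 j c * ((of_rat c' + of_nat j) * gamma_quot 0 j c'))))"
      by (intro pcong_scale_2 pcong_mult S3 pcong_refl ig) simp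
    finally show ?thesis unfolding c' dd E_def by (simp add: ac_simps)
  qed
  have "pcong 1 E (((-1) ^ j * pochhammer (of_rat (1/2) :: 'p padic) j / fact j) * ((-1) ^ j * c_rest j / fact j) *
      ((-1) ^ j * pochhammer (of_rat c' :: 'p padic) j / fact j))"
    unfolding E_def by (intro pcong_mult E1 E2 E3)
  also have "\<dots> = ((-1) ^ j) ^ 3 * V j" by (simp only: V_def power3_eq_cube divide_inverse inverse_mult_distrib ac_simps)
  finally have E: "pcong 1 E (((-1) ^ j) ^ 3 * V j)" .
  have iV: "padic_integral (V j)" using integral_V[OF jp] .
  have "pcong 2 (G_term j) (P * ((-1) ^ j * (1 / of_int d + of_nat j) * (((-1) ^ j) ^ 3 * V j)))"
    by (rule pcong_trans[OF G]) (intro pcong_scale_2 pcong_mult E pcong_refl, simp_all)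
  also have "P * ((-1) ^ j * (1 / of_int d + of_nat j) * (((-1) ^ j) ^ 3 * V j)) =
      P * ((((-1) ^ j) ^ 4) * ((1 / of_int d + of_nat j) * V j))"
    by (simp only: power3_eq_cube power4_eq_xxxx ac_simps)
  also have "((-1) ^ j) ^ 4 = (1 :: 'p padic)" by (simp flip: power_mult)
  finally have G2: "pcong 2 (G_term j) (P * ((1 / of_int d + of_nat j) * V j))" by simp
  have "pcong 2 ((1 + P) * G_term j) ((1 + P) * (P * ((1 / of_int d + of_nat j) * V j)))"
    using G2 by (intro pcong_mult) auto
  also have "pcong 2 \<dots> (F_term j + P * (of_nat j * V j))"
    unfolding pcong_iff
  proof (intro conjI exI)
    show "padic_integral ((1 / of_int d + of_nat j) * V j)" using iV by simp
    have e: "P * ((1 / of_int d + of_nat j) * V j) = F_term j + P * (of_nat j * V j)"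
      unfolding F_term_V[OF j(1)] by (simp add: algebra_simps)
    show "padic_integral (F_term j + P * (of_nat j * V j))"
      unfolding e[symmetric] using iV by simp
    show "(1 + P) * (P * ((1 / of_int d + of_nat j) * V j)) =
        F_term j + P * (of_nat j * V j) + P ^ 2 * ((1 / of_int d + of_nat j) * V j)"
      unfolding e[symmetric] by (simp only: distrib_right mult_1 power2_eq_square mult.assoc)
  qed
  also have "pcong 2 \<dots> (F_term j + P * (of_int (poly (pderiv (pCons 0 R)) (int j)) / R0))"
  proof (intro pcong_add pcong_scale_2 pcong_refl)
    show "padic_integral (F_term j)" unfolding F_term_V[OF j(1)] using iV unit_d by simp
    show "pcong 1 (of_nat j * V j) (of_int (poly (pderiv (pCons 0 R)) (int j)) / R0)"
      by (rule pcong_sym[OF V_pderiv[OF j(1) jp]])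
  qed
  finally show ?thesis .
qed

section \<open>Terms beyond \<open>h\<close>, which vanish on both sides\<close>

lemma pochhammer_half:
  assumes "h < j"
  shows "pochhammer (of_rat (1/2)) j = P / 2 * (\<Prod>i\<in>{..<j} - {h}. of_rat (1/2) + of_nat i)"
proof -
  have "pochhammer (of_rat (1/2) :: 'p padic) j = (\<Prod>i<j. of_rat (1/2) + of_nat i)"
    by (simp add: pochhammer_prod lessThan_atLeast0)
  also have "\<dots> = (of_rat (1/2) + of_nat h) * (\<Prod>i\<in>{..<j} - {h}. of_rat (1/2) + of_nat i)"
    using assms by (subst prod.remove[of _ h]) auto
  also have "(of_rat (1/2) + of_nat h :: 'p padic) = P / 2"
    unfolding of_rat_half by (simp add: card_eq field_simps)
  finally show ?thesis .
qed

text \<open>The rising factorials of \<open>1/2\<close> and of \<open>c\<close> each contain a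
  factor \<open>P\<close>, at the indices \<open>h\<close> and \<open>r\<close>. One of them
  survives in \<open>V j\<close>, so the derivative term also acquires a second factor
  \<open>P\<close>.\<close>

lemma term_high_F:
  assumes j: "h < j" "j < CARD('p)"
  shows "pcong 2 (F_term j + P * (of_int (poly (pderiv (pCons 0 R)) (int j)) / R0)) 0"
proof -
  have rj: "r < j" using r_le_h j by simp
  define w where "w = 1 / 2 * (\<Prod>i\<in>{..<j} - {h}. of_rat (1/2) + of_nat i) * c_rest j *
      pochhammer (of_rat c') j / (fact j ^ 3 :: 'p padic)"
  have iw: "padic_integral w"
    unfolding w_def using j(2) unit_2
    by (intro padic_integral_divide padic_integral_mult padic_integral_pochhammer padic_unit_power padic_unit_fact padic_integral_prod) auto
  have V: "V j = P * w" unfolding V_def pochhammer_half[OF j(1)] w_def by simp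
  have "pcong 2 (P * (of_int (poly (pderiv (pCons 0 R)) (int j)) / R0)) (P * (of_nat j * V j))"
    by (rule pcong_scale_2[OF V_pderiv[OF rj j(2)]])
  also have "pcong 2 \<dots> 0"
    by (rule pcong_2_0[of "of_nat j * w"]) (use iw in \<open>simp_all add: V power2_eq_square\<close>)
  finally have 1: "pcong 2 (P * (of_int (poly (pderiv (pCons 0 R)) (int j)) / R0)) 0" .
  have "pcong 2 (F_term j) 0"
    by (rule pcong_2_0[of "1 / of_int d * w"])
       (use iw in \<open>simp_all add: F_term_V[OF rj] V power2_eq_square\<close>, use unit_d in \<open>simp add: divide_inverse padic_unit_def\<close>)
  from pcong_add[OF this 1] show ?thesis by simp
qed

text \<open>The parameters \<open>1/2\<close> and \<open>1/d\<close> both lie below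
  \<open>j / (p - 1)\<close>, giving two factors \<open>P\<close>.\<close>

lemma term_high_G:
  assumes j: "h < j" "j + 2 \<le> CARD('p)"
  shows "pcong 2 ((1 + P) * G_term j) 0"
proof -
  let ?s = "CARD('p) - 1 - r"
  obtain b1 where b1: "pcong 2 (of_rat (1/2) :: 'p padic) (of_nat (Suc h + CARD('p) * b1))" by (rule residue_half)
  obtain b2 where b2: "pcong 2 (of_rat c :: 'p padic) (of_nat (Suc ?s + CARD('p) * b2))" by (rule residue_c)
  obtain b3 where b3: "pcong 2 (of_rat c' :: 'p padic) (of_nat (Suc r + CARD('p) * b3))" by (rule residue_c')
  have ig: "padic_integral (gamma_quot s j (1/2) :: 'p padic)" "padic_integral (gamma_quot s j c :: 'p padic)"
    "padic_integral (gamma_quot s j c' :: 'p padic)" for s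
    using padic_integral_gamma_quot[OF odd_card j(2) b1] padic_integral_gamma_quot[OF odd_card j(2) b2]
      padic_integral_gamma_quot[OF odd_card j(2) b3] by simp_all
  have t: "(1/2 :: rat) < of_nat j / (of_nat CARD('p) - 1)" "(1 / of_int d :: rat) < of_nat j / (of_nat CARD('p) - 1)"
    using index_le_half[of j] index_le_d[of j] j r_le_h by auto
  have cpos: "c > 0" "c < 1" "c' > 0" "c' < 1" using c_bounds d_bounds by linarith+
  \<comment> \<open>The third parameter may lie on either side of \<open>j / (p - 1)\<close>; only
    integrality of its factor is needed.\<close>
  have fi: "padic_integral (G_factor j m :: 'p padic)"
    if "\<And>s. padic_integral (gamma_quot s j m :: 'p padic)" "0 < m" "m < 1" for m
  proof (cases "of_nat j / (of_nat CARD('p) - 1) \<le> m")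
    case True
    then show ?thesis using G_factor_le[OF True that(3)] that(1) by simp
  next
    case False
    then show ?thesis using G_factor_gt[OF j(2), of m] that by simp
  qed
  have f1: "G_factor j (1/2) = - P * gamma_quot 1 j (1/2)" using t by (intro G_factor_gt j) auto
  from c_cases obtain z :: "'p padic" where z: "padic_integral z" "G_factor j c * G_factor j c' = P * z"
  proof
    assume "c = 1 / of_int d"
    then have "G_factor j c = - P * gamma_quot 1 j c" using t cpos by (intro G_factor_gt j) auto
    then show thesis
      using ig(2)[of 1] fi[OF ig(3) cpos(3,4)] by (intro that[of "- (gamma_quot 1 j c * G_factor j c')"]) auto
  next
    assume "c' = 1 / of_int d"
    then have "G_factor j c' = - P * gamma_quot 1 j c'" using t cpos by (intro G_factor_gt j) auto
    then show thesis
      using ig(3)[of 1] fi[OF ig(2) cpos(1,2)] by (intro that[of "- (gamma_quot 1 j c' * G_factor j c)"]) auto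
  qed
  show ?thesis
  proof (rule pcong_2_0)
    show "padic_integral ((1 + P) * ((-1) ^ j * (- gamma_quot 1 j (1/2) * z)))" using ig(1)[of 1] z(1) by simp
    have "G_term j = (-1) ^ j * (G_factor j (1/2) * (G_factor j c * G_factor j c'))"
      by (simp add: G_term_def ac_simps)
    also have "\<dots> = P ^ 2 * ((-1) ^ j * (- gamma_quot 1 j (1/2) * z))"
      unfolding f1 z(2) by (simp add: power2_eq_square ac_simps)
    finally show "(1 + P) * G_term j = P ^ 2 * ((1 + P) * ((-1) ^ j * (- gamma_quot 1 j (1/2) * z)))"
      by (simp add: ac_simps)
  qed
qed

section \<open>Summation over \<open>j\<close>\<close>

lemma term_pcong:
  assumes "j + 2 \<le> CARD('p)"
  shows "pcong 2 ((1 + P) * G_term j) (F_term j + P * (of_int (poly (pderiv (pCons 0 R)) (int j)) / R0))"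
proof -
  consider "j \<le> r" | "r < j" "j \<le> h" | "h < j" by linarith
  then show ?thesis
  proof cases
    case 3
    have "j < CARD('p)" using assms by simp
    from pcong_trans[OF term_high_G[OF 3 assms] pcong_sym[OF term_high_F[OF 3 this]]] show ?thesis .
  qed (use term_low term_mid assms in auto)
qed

lemma sum_pcong:
  "pcong 2 (- 1 / (P - 1) * (\<Sum>j = 0..CARD('p) - 2. G_term j)) (\<Sum>j = 0..CARD('p) - 1. F_term j)"
proof -
  define S where "S j = F_term j + P * (of_int (poly (pderiv (pCons 0 R)) (int j)) / R0)" for j
  have p2: "CARD('p) \<ge> 3" using card_eq h_pos by simp
  have ip1: "pcong 2 (- 1 / (P - 1)) (1 + P)"
    unfolding pcong_iff
  proof (intro conjI exI)
    show "padic_integral (- 1 / (P - 1))" "padic_integral (1 + P)"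
      using padic_unit_card_minus_1[where 'p = 'p] by simp_all
    show "- 1 / (P - 1) = 1 + P + P ^ 2 * (- 1 / (P - 1))"
      using padic_unitD(3)[OF padic_unit_card_minus_1[where 'p = 'p]] by (simp add: field_simps power2_eq_square)
  qed
  have iG: "padic_integral ((1 + P) * G_term j)" if "j + 2 \<le> CARD('p)" for j
    using pcong_integral(1)[OF term_pcong[OF that]] .
  \<comment> \<open>The termwise congruence gives integrality only of the product with
    \<open>1 + P\<close>; this factor is a unit.\<close>
  have iG': "padic_integral (G_term j)" if "j + 2 \<le> CARD('p)" for j
  proof -
    have "\<not> int CARD('p) dvd 1 + int CARD('p)"
      using p2 by (simp add: dvd_add_left_iff)
    from padic_unit_of_int[OF this] have "padic_unit (1 + P)" by simp
    then show ?thesis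
      using padic_integral_divide[OF iG[OF that]] padic_unitD(3)[of "1 + P"] by fastforce
  qed
  have rng: "j + 2 \<le> CARD('p)" if "j \<in> {0..CARD('p) - 2}" for j using that p2 by auto
  have "pcong 2 (- 1 / (P - 1) * (\<Sum>j = 0..CARD('p) - 2. G_term j)) ((1 + P) * (\<Sum>j = 0..CARD('p) - 2. G_term j))"
    by (intro pcong_mult ip1 pcong_sum pcong_refl iG' rng)
  also have "\<dots> = (\<Sum>j = 0..CARD('p) - 2. (1 + P) * G_term j)" by (simp add: sum_distrib_left)
  also have "pcong 2 \<dots> (\<Sum>j = 0..CARD('p) - 2. S j)"
    unfolding S_def by (intro pcong_sum term_pcong rng)
  \<comment> \<open>The sum in \<open>padic_G\<close> stops one index earlier than the
    hypergeometric sum. The additional term is 0 modulo the square of the prime, and it completes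
    the derivative sum to all residues.\<close>
  also have "pcong 2 \<dots> ((\<Sum>j = 0..CARD('p) - 2. S j) + S (CARD('p) - 1))"
  proof -
    have "pcong 2 (S (CARD('p) - 1)) 0" unfolding S_def by (rule term_high_F) (use card_eq h_pos in auto)
    moreover have "padic_integral (\<Sum>j = 0..CARD('p) - 2. S j)" using \<open>pcong 2 _ (\<Sum>j = 0..CARD('p) - 2. S j)\<close>
      by (rule pcong_integral(2))
    ultimately have "pcong 2 ((\<Sum>j = 0..CARD('p) - 2. S j) + 0) ((\<Sum>j = 0..CARD('p) - 2. S j) + S (CARD('p) - 1))"
      by (intro pcong_add[OF pcong_refl pcong_sym])
    then show ?thesis by simp
  qed
  also have "(\<Sum>j = 0..CARD('p) - 2. S j) + S (CARD('p) - 1) = (\<Sum>j = 0..CARD('p) - 1. S j)"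
  proof -
    have "CARD('p) - 1 = Suc (CARD('p) - 2)" using p2 by simp
    then show ?thesis by simp
  qed
  also have "(\<Sum>j = 0..CARD('p) - 1. S j) =
      (\<Sum>j = 0..CARD('p) - 1. F_term j) + P * (of_int (\<Sum>j<CARD('p). poly (pderiv (pCons 0 R)) (int j)) / R0)"
  proof -
    have "{0..CARD('p) - 1} = {..<CARD('p)}" using p2 by auto
    then show ?thesis by (simp add: S_def sum.distrib sum_distrib_left sum_divide_distrib)
  qed
  also have "pcong 2 \<dots> ((\<Sum>j = 0..CARD('p) - 1. F_term j) + P * 0)"
  proof (intro pcong_add pcong_scale_2)
    have "padic_integral (F_term j)" if "j \<in> {0..CARD('p) - 1}" for j
      by (rule pcong_integral(1)[OF F_term_ratio]) (use that p2 in auto)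
    then show "pcong 2 (\<Sum>j = 0..CARD('p) - 1. F_term j) (\<Sum>j = 0..CARD('p) - 1. F_term j)"
      by (intro pcong_sum pcong_refl)
    \<comment> \<open>The degree of \<open>x R\<close> is at most \<open>p + h = 3 * h + 1\<close>,
      which is at most \<open>2 * p - 2 = 4 * h\<close> since \<open>h > 0\<close>.\<close>
    have "degree (pCons 0 R) \<le> Suc (degree R)" by (rule degree_pCons_le)
    also have "degree R \<le> h + (CARD('p) - 1 - r) + r"
      unfolding R_def by (metis degree_mult_le degree_rising_poly add_mono order_trans order_refl)
    also have "Suc (h + (CARD('p) - 1 - r) + r) \<le> 2 * CARD('p) - 2"
      using card_eq r_le_h h_pos by auto
    finally have "degree (pCons 0 R) \<le> 2 * CARD('p) - 2" by simp
    from prime_dvd_sum_pderiv[OF prime_card this]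
    have "[(\<Sum>j<CARD('p). poly (pderiv (pCons 0 R)) (int j)) = 0] (mod int CARD('p) ^ 1)"
      by (simp add: cong_0_iff)
    from pcong_of_int[OF this]
    have "pcong 1 (of_int (\<Sum>j<CARD('p). poly (pderiv (pCons 0 R)) (int j)) / R0) (of_int 0 / R0)"
      using unit_R0 padic_unitD(1)[OF unit_R0] by (intro pcong_divide pcong_refl)
    then show "pcong 1 (of_int (\<Sum>j<CARD('p). poly (pderiv (pCons 0 R)) (int j)) / R0) 0" by simp
  qed
  finally show ?thesis by simp
qed

end

section \<open>The theorem, by choosing the parameters for each residue class of
  \<open>p\<close>\<close>

theorem theorem2p5:
  fixes d :: int and p :: nat
  assumes "d \<ge> 2"
    and "p = CARD('p :: prime_card)"
    and "odd p"
    and "[int p = 1] (mod d) \<or> [int p = -1] (mod d)"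
  shows "padic_cong
           (padic_G [1/2, 1 / of_int d, 1 - 1 / of_int d] :: 'p padic)
           (of_rat (truncated_hypergeometric [1/2, 1 / of_int d, 1 - 1 / of_int d] [1, 1] 1 (p - 1)))
           (p ^ 2)"
proof -
  have p: "CARD('p) = p" using assms(2) by simp
  have pp: "prime p" unfolding assms(2) by (rule prime_card)
  define h where "h = (p - 1) div 2"
  have h: "p = 2 * h + 1" using assms(3) by (auto simp: h_def elim: oddE)
  have h0: "h > 0" using h pp prime_gt_1_nat[of p] by simp
  have nd: "\<not> int p dvd d"
  proof
    assume "int p dvd d"
    then have "[int p = 1] (mod int p) \<or> [int p = -1] (mod int p)" using assms(4) cong_dvd_modulus by blast
    then have "int p dvd int p - 1 \<or> int p dvd int p + 1" by (simp add: cong_iff_dvd_diff)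
    then have "int p dvd 1" by (metis dvd_add_right_iff dvd_diff_right_iff dvd_refl)
    then show False using h h0 by auto
  qed
  \<comment> \<open>For \<open>d = 2\<close> both congruences hold; the choice \<open>e = 1\<close>
    is then made.\<close>
  define e where "e = (if [int p = 1] (mod d) then 1 else -1 :: int)"
  have "[int p = e] (mod d)" using assms(4) by (auto simp: e_def)
  then obtain k where k: "int p = e + d * k" by (metis cong_iff_lin cong_sym mult.commute)
  have e_cases: "e = 1 \<or> e = -1" by (simp add: e_def)
  have k0: "k > 0"
  proof (rule ccontr)
    assume "\<not> k > 0"
    then have "d * k \<le> 0" using assms(1) by (simp add: mult_nonneg_nonpos)
    then show False using k e_cases h h0 by auto
  qed
  \<comment> \<open>From \<open>p = e + d * k\<close>, the floor of \<open>(p - 1) / d\<close> is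
    \<open>k\<close> when \<open>e = 1\<close>, and \<open>k - 1\<close> when \<open>e = -1\<close>,
    since then \<open>p - 1 = d * k - 2\<close> and \<open>d >= 2\<close>.\<close>
  define r where "r = nat (if e = 1 then k else k - 1)"
  have r: "int r = (if e = 1 then k else k - 1)" using k0 by (simp add: r_def)
  have le_r: "j \<le> r \<longleftrightarrow> d * int j \<le> int p - 1" for j
  proof (cases "e = 1")
    case True
    then have "d * int j \<le> int p - 1 \<longleftrightarrow> d * int j \<le> d * k" using k by simp
    also have "\<dots> \<longleftrightarrow> int j \<le> k" using assms(1) by simp
    finally show ?thesis using r True by auto
  next
    case False
    then have k': "int p = d * k - 1" using k e_cases by simp
    have "d * int j \<le> int p - 1 \<longleftrightarrow> int j < k"
    proof
      assume "int j < k"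
      then have "d * int j \<le> d * (k - 1)" using assms(1) by (intro mult_left_mono) auto
      then show "d * int j \<le> int p - 1" using k' assms(1) by (simp add: algebra_simps)
    next
      assume "d * int j \<le> int p - 1"
      then have "d * int j < d * k" using k' by simp
      then show "int j < k" using assms(1) by simp
    qed
    then show ?thesis using r False by auto
  qed
  have rh: "r \<le> h"
  proof -
    have "2 * int r \<le> d * int r" using assms(1) by (intro mult_right_mono) auto
    also have "\<dots> \<le> int p - 1" using le_r[of r] by simp
    finally show ?thesis using h by simp
  qed
  \<comment> \<open>In either case \<open>c + r = p / d\<close>: for \<open>e = 1\<close> this is
    \<open>1/d + k\<close>, for \<open>e = -1\<close> it is \<open>k - 1/d\<close>.\<close>
  define c :: rat where "c = (if e = 1 then 1 / of_int d else 1 - 1 / of_int d)"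
  have dk: "(of_nat p :: rat) = of_int e + of_int d * of_int k" using k by (metis of_int_add of_int_mult of_int_of_nat_eq)
  have d0: "(of_int d :: rat) \<noteq> 0" using assms(1) by simp
  have rr: "(of_nat r :: rat) = (if e = 1 then of_int k else of_int k - 1)"
    using r by (metis of_int_1 of_int_diff of_int_of_nat_eq)
  interpret G_parameters "TYPE('p)" d r h c "1 - c"
  proof
    show "c + of_nat r = of_nat CARD('p) / of_int d"
      unfolding p dk rr using d0 e_cases by (auto simp: c_def field_simps)
    show "c = 1 / of_int d \<or> 1 - c = 1 / of_int d" by (simp add: c_def)
  qed (use assms(1) nd rh h le_r p in auto)
  \<comment> \<open>The locale may have the two parameters in the opposite order; both sums are
    symmetric in them.\<close>
  have cc: "f c * f (1 - c) = f (1 / of_int d) * f (1 - 1 / of_int d)" for f :: "rat \<Rightarrow> 'p padic"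
    by (simp add: c_def mult.commute)
  have "(padic_G [1/2, 1 / of_int d, 1 - 1 / of_int d] :: 'p padic) =
      - 1 / (P - 1) * (\<Sum>j = 0..CARD('p) - 2. G_term j)"
    unfolding padic_G_def
  proof (intro arg_cong2[where f = "(*)"] refl sum.cong)
    fix j
    \<comment> \<open>The cube of the sign collapses to the single sign in \<open>G_term\<close>;
      the cubed gamma value is shared among the three \<open>G_factor\<close>s.\<close>
    have sgn: "((-1) ^ j) ^ 3 = ((-1) ^ j :: 'p padic)" by (simp add: power3_eq_cube flip: power_mult_distrib)
    have "G_term j = (-1) ^ j * (G_factor j (1/2) * (G_factor j (1 / of_int d) * G_factor j (1 - 1 / of_int d)))"
      unfolding G_term_def cc[of "G_factor j", symmetric] by (simp only: mult.assoc)
    then show "(let t = of_nat j / (of_nat CARD('p) - 1)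
        in ((-1) ^ j * padic_Gamma_rat t) ^ length [1/2, 1 / of_int d, 1 - 1 / of_int d] *
           (\<Prod>m\<leftarrow>[1/2, 1 / of_int d, 1 - 1 / of_int d]. padic_Gamma_rat (frac (m - t)) / padic_Gamma_rat m *
              (- of_nat CARD('p)) powi (- \<lfloor>m - t\<rfloor>))) = G_term j"
      by (simp add: G_factor_def Let_def power_mult_distrib sgn power3_eq_cube numeral_3_eq_3)
  qed
  moreover have "(of_rat (truncated_hypergeometric [1/2, 1 / of_int d, 1 - 1 / of_int d] [1, 1] 1 (p - 1)) :: 'p padic) =
      (\<Sum>j = 0..CARD('p) - 1. F_term j)"
  proof -
    have poch: "of_rat (pochhammer m j) = pochhammer (of_rat m :: 'p padic) j" for m j
      by (simp add: pochhammer_prod of_rat_prod of_rat_add)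
    have fct: "of_rat (fact j) = (fact j :: 'p padic)" for j
      by (metis of_nat_fact of_rat_of_nat_eq)
    have "F_term j = pochhammer (of_rat (1/2)) j * (pochhammer (of_rat (1 / of_int d)) j *
        pochhammer (of_rat (1 - 1 / of_int d)) j) / fact j ^ 3" for j
      unfolding F_term_def cc[of "\<lambda>m. pochhammer (of_rat m) j", symmetric] by (simp only: mult.assoc)
    then show ?thesis
      unfolding truncated_hypergeometric_def p of_rat_sum
      by (simp add: of_rat_mult of_rat_divide poch fct pochhammer_fact[symmetric] power3_eq_cube)
  qed
  ultimately show ?thesis using sum_pcong unfolding pcong_def p by simp
qed

end
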